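(* Let $\{\mathbf n=\mathbf v\oplus\mathbf z,\langle\,,\rangle,\mathbf J_Z\}$ be a metric 2-step nilpotent Lie algebra, let $\sigma$ be an involutive orthogonal transformation of $\mathbf v$ commuting with every $\mathbf J_Z$, $Z\in\mathbf z$, and let $\mathbf n_\sigma=\{\mathbf v\oplus\mathbf z,\langle\,,\rangle,\mathbf J_Z^\sigma=\sigma\mathbf J_Z\}$ be the $\sigma$-deformed Lie algebra, with corresponding left-invariant metrics $g$ and $g^\sigma$. Then for every full lattice $\Gamma$ in $\mathbf z$ and every $\delta>0$, the metrics induced by $g$ and $g^\sigma$ on the manifold with boundary $(B_\delta,T)$ are both Dirichlet isospectral and Neumann isospectral.
   Context: A metric 2-step nilpotent Lie algebra is a system $\{\mathbf n=\mathbf v\oplus\mathbf z,\langle\,,\rangle,\mathbf J_Z\}$ (finite-dimensional, real), where $\mathbf z=[\mathbf n,\mathbf n]$ is the center, $\langle\,,\rangle$ is an inner product with $\mathbf v\perp\mathbf z$, and the injective linear map $\mathbf J:\mathbf z\to \mathrm{End}(\mathbf v)$ (with skew-symmetric values) is given by $\langle \mathbf J_Z(X),Y\rangle=\langle[X,Y],Z\rangle$ for $X,Y\in\mathbf v$, $Z\in\mathbf z$; conversely the bracket is determined by $\mathbf J$. The corresponding Lie group $N$ is $\mathbf v\oplus\mathbf z$ with product $(X,Z)(X',Z')=(X+X',Z+Z'+\tfrac12[X,X'])$, with the left-invariant metric extending $\langle\,,\rangle$. Ball$\times$Torus-type manifold: a full lattice $\Gamma\subset\mathbf z$ is a discrete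 subgroup of $N$, and $\Gamma\backslash N$ with the factor metric is a principal torus bundle over $\mathbf v$ with fiber $T=\Gamma\backslash\mathbf z$. With $B_\delta$ the Euclidean ball of radius $\delta$ around the origin of $\mathbf v$, $(B_\delta,T)$ denotes the restriction of this bundle to $B_\delta$; it is a compact Riemannian manifold with boundary $(S_\delta,T)$, the restriction of the bundle to $S_\delta=\partial B_\delta$. Dirichlet (Neumann) isospectral means that the Laplacians acting on functions with Dirichlet (Neumann) boundary condition have the same spectrum with multiplicities. *)

theory Defs
  imports "HOL-Analysis.Analysis" "HOL-Library.Function_Algebras"
begin

section \<open>Metric 2-step nilpotent Lie algebras and their groups\<close>

text \<open>
  The Lie algebra is the product \<open>'v \<times> 'z\<close> of two Euclidean spaces; the library's inner product
  on the product type is the orthogonal sum. The algebra is given by \<open>J\<close>, and the bracket of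
  \<open>X\<close> and \<open>X'\<close> is the vector of \<open>'z\<close> whose inner product with each \<open>Z\<close> is
  the inner product of \<open>J Z X\<close> with \<open>X'\<close>; see \<open>lie_bracket_inner\<close> below.
\<close>

definition lie_bracket ::
  "('z::euclidean_space \<Rightarrow> 'v::euclidean_space \<Rightarrow> 'v) \<Rightarrow> 'v \<times> 'z \<Rightarrow> 'v \<times> 'z \<Rightarrow> 'v \<times> 'z" where
  "lie_bracket J p q = (0, \<Sum>b\<in>Basis. (J b (fst p) \<bullet> fst q) *\<^sub>R b)"

definition metric_two_step_nilpotent ::
  "('z::euclidean_space \<Rightarrow> 'v::euclidean_space \<Rightarrow> 'v) \<Rightarrow> bool" where
  "metric_two_step_nilpotent J \<longleftrightarrow>
     (\<forall>Z. linear (J Z)) \<and> (\<forall>X. linear (\<lambda>Z. J Z X)) \<and> inj J \<and>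
     (\<forall>Z X Y. J Z X \<bullet> Y = - (X \<bullet> J Z Y)) \<and>
     span {lie_bracket J p q | p q. True} = {0} \<times> UNIV \<and>
     {p. \<forall>q. lie_bracket J p q = 0} = {0} \<times> UNIV"

definition sigma_deform ::
  "('v \<Rightarrow> 'v) \<Rightarrow> ('z \<Rightarrow> 'v \<Rightarrow> 'v) \<Rightarrow> 'z \<Rightarrow> 'v \<Rightarrow> 'v" where
  "sigma_deform \<sigma> J = (\<lambda>Z. \<sigma> \<circ> J Z)"

definition nil_mult ::
  "('z::euclidean_space \<Rightarrow> 'v::euclidean_space \<Rightarrow> 'v) \<Rightarrow> 'v \<times> 'z \<Rightarrow> 'v \<times> 'z \<Rightarrow> 'v \<times> 'z" where
  "nil_mult J p q = p + q + (1/2) *\<^sub>R lie_bracket J p q"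

text \<open>The group inverse of \<open>p\<close> is \<open>- p\<close>. The metric at \<open>p\<close> pulls the inner product at the
  identity back along the differential of left translation by the inverse of \<open>p\<close>.\<close>

definition left_inv_metric ::
  "('z::euclidean_space \<Rightarrow> 'v::euclidean_space \<Rightarrow> 'v) \<Rightarrow> 'v \<times> 'z \<Rightarrow> 'v \<times> 'z \<Rightarrow> 'v \<times> 'z \<Rightarrow> real" where
  "left_inv_metric J p u w =
     frechet_derivative (nil_mult J (- p)) (at p) u \<bullet>
     frechet_derivative (nil_mult J (- p)) (at p) w"


section \<open>The Laplacian of a Riemannian metric on a Euclidean space\<close>

text \<open>A metric is a function \<open>g\<close> with \<open>g p u w\<close> the inner product of the tangent vectors
  \<open>u\<close> and \<open>w\<close> at \<open>p\<close>; the standard basis of the Euclidean space provides global coordinates.\<close>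

definition gram_det :: "('a::euclidean_space \<Rightarrow> 'a \<Rightarrow> 'a \<Rightarrow> real) \<Rightarrow> 'a \<Rightarrow> real" where
  "gram_det g p = (\<Sum>\<pi> | \<pi> permutes Basis. of_int (sign \<pi>) * (\<Prod>b\<in>Basis. g p b (\<pi> b)))"

definition grad ::
  "('a::euclidean_space \<Rightarrow> 'a \<Rightarrow> 'a \<Rightarrow> real) \<Rightarrow> ('a \<Rightarrow> real) \<Rightarrow> 'a \<Rightarrow> 'a" where
  "grad g f p = (THE w. \<forall>u. g p w u = frechet_derivative f (at p) u)"

definition divergence ::
  "('a::euclidean_space \<Rightarrow> 'a \<Rightarrow> 'a \<Rightarrow> real) \<Rightarrow> ('a \<Rightarrow> 'a) \<Rightarrow> 'a \<Rightarrow> real" where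
  "divergence g W p =
     (\<Sum>b\<in>Basis. frechet_derivative (\<lambda>q. sqrt (gram_det g q) * (W q \<bullet> b)) (at p) b) /
     sqrt (gram_det g p)"

definition laplacian ::
  "('a::euclidean_space \<Rightarrow> 'a \<Rightarrow> 'a \<Rightarrow> real) \<Rightarrow> ('a \<Rightarrow> real) \<Rightarrow> 'a \<Rightarrow> real" where
  "laplacian g f = divergence g (grad g f)"

primrec times_cont_diff :: "nat \<Rightarrow> ('a::euclidean_space \<Rightarrow> real) \<Rightarrow> bool" where
  "times_cont_diff 0 f = continuous_on UNIV f"
| "times_cont_diff (Suc k) f =
     ((\<forall>x. f differentiable (at x)) \<and>
      (\<forall>b\<in>Basis. times_cont_diff k (\<lambda>x. frechet_derivative f (at x) b)))"

definition smooth_fun :: "('a::euclidean_space \<Rightarrow> real) \<Rightarrow> bool" where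
  "smooth_fun f \<longleftrightarrow> (\<forall>k. times_cont_diff k f)"


section \<open>Functions on the torus bundle over the ball\<close>

definition full_lattice :: "'z::euclidean_space set \<Rightarrow> bool" where
  "full_lattice \<Gamma> \<longleftrightarrow>
     (\<exists>B. independent B \<and> span B = UNIV \<and>
          \<Gamma> = {\<Sum>b\<in>B. of_int (k b) *\<^sub>R b | k :: 'z \<Rightarrow> int. True})"

text \<open>
  A lattice vector \<open>\<gamma>\<close> acts on the group by left multiplication with \<open>(0, \<gamma>)\<close>, which is
  the translation \<open>(X, Z) \<mapsto> (X, Z + \<gamma>)\<close> whatever the bracket is (\<open>nil_mult_lattice\<close>
  below). So the manifold does not depend on \<open>J\<close>, and functions on it are the
  functions on \<open>cball 0 \<delta> \<times> UNIV\<close> that are periodic in the second argument.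
\<close>

definition lattice_periodic :: "'z::euclidean_space set \<Rightarrow> ('v \<times> 'z \<Rightarrow> real) \<Rightarrow> bool" where
  "lattice_periodic \<Gamma> f \<longleftrightarrow> (\<forall>X Z. \<forall>\<gamma>\<in>\<Gamma>. f (X, Z + \<gamma>) = f (X, Z))"

text \<open>A function on the manifold is represented by its extension by 0, so that distinct
  representatives are distinct functions on the manifold.\<close>

definition restrict_ball ::
  "real \<Rightarrow> ('v::euclidean_space \<times> 'z::euclidean_space \<Rightarrow> real) \<Rightarrow> 'v \<times> 'z \<Rightarrow> real" where
  "restrict_ball \<delta> F = (\<lambda>p. if fst p \<in> cball 0 \<delta> then F p else 0)"

text \<open>
  Smoothness up to the boundary means that there is a smooth periodic extension \<open>F\<close> to the
  whole bundle. All conditions imposed on \<open>F\<close> below, including those on its derivative at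
  boundary points, depend only on the values of \<open>F\<close> over the closed ball.
\<close>

definition dirichlet_eigenspace ::
  "'z::euclidean_space set \<Rightarrow> real \<Rightarrow> ('v::euclidean_space \<times> 'z \<Rightarrow> 'v \<times> 'z \<Rightarrow> 'v \<times> 'z \<Rightarrow> real) \<Rightarrow>
    real \<Rightarrow> ('v \<times> 'z \<Rightarrow> real) set" where
  "dirichlet_eigenspace \<Gamma> \<delta> g \<mu> =
     {restrict_ball \<delta> F | F.
        smooth_fun F \<and> lattice_periodic \<Gamma> F \<and>
        (\<forall>p \<in> ball 0 \<delta> \<times> UNIV. laplacian g F p = - \<mu> * F p) \<and>
        (\<forall>p \<in> sphere 0 \<delta> \<times> UNIV. F p = 0)}"

text \<open>A vector \<open>w\<close> is tangent to the boundary at \<open>p\<close> iff its component in \<open>'v\<close> is tangent to the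
  sphere through \<open>fst p\<close>.\<close>

definition boundary_normal ::
  "('v::euclidean_space \<times> 'z::euclidean_space \<Rightarrow> 'v \<times> 'z \<Rightarrow> 'v \<times> 'z \<Rightarrow> real) \<Rightarrow>
    'v \<times> 'z \<Rightarrow> 'v \<times> 'z \<Rightarrow> bool" where
  "boundary_normal g p \<nu> \<longleftrightarrow> (\<forall>w. fst p \<bullet> fst w = 0 \<longrightarrow> g p \<nu> w = 0)"

definition neumann_eigenspace ::
  "'z::euclidean_space set \<Rightarrow> real \<Rightarrow> ('v::euclidean_space \<times> 'z \<Rightarrow> 'v \<times> 'z \<Rightarrow> 'v \<times> 'z \<Rightarrow> real) \<Rightarrow>
    real \<Rightarrow> ('v \<times> 'z \<Rightarrow> real) set" where
  "neumann_eigenspace \<Gamma> \<delta> g \<mu> =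
     {restrict_ball \<delta> F | F.
        smooth_fun F \<and> lattice_periodic \<Gamma> F \<and>
        (\<forall>p \<in> ball 0 \<delta> \<times> UNIV. laplacian g F p = - \<mu> * F p) \<and>
        (\<forall>p \<in> sphere 0 \<delta> \<times> UNIV. \<forall>\<nu>. boundary_normal g p \<nu> \<longrightarrow>
            frechet_derivative F (at p) \<nu> = 0)}"


section \<open>Isospectrality\<close>

interpretation fun_space: vector_space "\<lambda>(c::real) (f::'a \<Rightarrow> real) x. c * f x"
  by unfold_locales (auto simp: algebra_simps fun_eq_iff)

text \<open>The dimension as an element of \<open>enat\<close>; the library's \<open>dim\<close> would identify infinite
  dimension with 0.\<close>

definition multiplicity_of :: "('a \<Rightarrow> real) set \<Rightarrow> enat" where
  "multiplicity_of E =
     (SUP S \<in> {S. finite S \<and> S \<subseteq> E \<and> fun_space.independent S}. enat (card S))"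

definition dirichlet_isospectral ::
  "'z::euclidean_space set \<Rightarrow> real \<Rightarrow> ('v::euclidean_space \<times> 'z \<Rightarrow> 'v \<times> 'z \<Rightarrow> 'v \<times> 'z \<Rightarrow> real) \<Rightarrow>
    ('v \<times> 'z \<Rightarrow> 'v \<times> 'z \<Rightarrow> 'v \<times> 'z \<Rightarrow> real) \<Rightarrow> bool" where
  "dirichlet_isospectral \<Gamma> \<delta> g g' \<longleftrightarrow>
     (\<forall>\<mu>. multiplicity_of (dirichlet_eigenspace \<Gamma> \<delta> g \<mu>) =
          multiplicity_of (dirichlet_eigenspace \<Gamma> \<delta> g' \<mu>))"

definition neumann_isospectral ::
  "'z::euclidean_space set \<Rightarrow> real \<Rightarrow> ('v::euclidean_space \<times> 'z \<Rightarrow> 'v \<times> 'z \<Rightarrow> 'v \<times> 'z \<Rightarrow> real) \<Rightarrow>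
    ('v \<times> 'z \<Rightarrow> 'v \<times> 'z \<Rightarrow> 'v \<times> 'z \<Rightarrow> real) \<Rightarrow> bool" where
  "neumann_isospectral \<Gamma> \<delta> g g' \<longleftrightarrow>
     (\<forall>\<mu>. multiplicity_of (neumann_eigenspace \<Gamma> \<delta> g \<mu>) =
          multiplicity_of (neumann_eigenspace \<Gamma> \<delta> g' \<mu>))"


section \<open>Consistency of the conventions\<close>

lemma lie_bracket_inner:
  assumes "\<And>X. linear (\<lambda>Z. J Z X)"
  shows "snd (lie_bracket J p q) \<bullet> Z = J Z (fst p) \<bullet> fst q"
proof -
  have "J Z (fst p) = J (\<Sum>b\<in>Basis. (Z \<bullet> b) *\<^sub>R b) (fst p)"
    by (simp add: euclidean_representation)
  also have "\<dots> = (\<Sum>b\<in>Basis. (Z \<bullet> b) *\<^sub>R J b (fst p))"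
    using linear_sum[OF assms, of "\<lambda>b. (Z \<bullet> b) *\<^sub>R b" Basis "fst p"]
    by (simp add: linear_cmul[OF assms])
  finally have "J Z (fst p) \<bullet> fst q = (\<Sum>b\<in>Basis. (Z \<bullet> b) * (J b (fst p) \<bullet> fst q))"
    by (simp add: inner_sum_left)
  then show ?thesis
    by (simp add: lie_bracket_def inner_sum_right inner_commute[of _ Z] mult.commute)
qed

lemma nil_mult_lattice:
  assumes "metric_two_step_nilpotent J"
  shows "nil_mult J (0, \<gamma>) (X, Z) = (X, Z + \<gamma>)"
  using assms
  by (simp add: metric_two_step_nilpotent_def nil_mult_def lie_bracket_def linear_0 zero_prod_def)

lemma left_inv_metric_eq:
  assumes "metric_two_step_nilpotent J"
  shows "left_inv_metric J p u w =
    (u - (1/2) *\<^sub>R lie_bracket J p u) \<bullet> (w - (1/2) *\<^sub>R lie_bracket J p w)"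
proof -
  have lin: "linear (J Z)" for Z
    using assms by (simp add: metric_two_step_nilpotent_def)
  have "nil_mult J (- p) = (\<lambda>q. q - (1/2) *\<^sub>R lie_bracket J p q - p)"
    by (simp add: nil_mult_def lie_bracket_def fun_eq_iff linear_neg[OF lin] sum_negf)
  moreover have "linear (\<lambda>q. q - (1/2) *\<^sub>R lie_bracket J p q)"
    by (rule linearI)
      (simp_all add: lie_bracket_def inner_add_right scaleR_add_left sum.distrib algebra_simps
        prod_eq_iff scaleR_sum_right)
  then have "((\<lambda>q. q - (1/2) *\<^sub>R lie_bracket J p q) has_derivative
      (\<lambda>q. q - (1/2) *\<^sub>R lie_bracket J p q)) (at p)"
    by (simp add: linear_conv_bounded_linear bounded_linear_imp_has_derivative)
  then have "((\<lambda>q. q - (1/2) *\<^sub>R lie_bracket J p q - p) has_derivative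
      (\<lambda>q. q - (1/2) *\<^sub>R lie_bracket J p q)) (at p)"
    using has_derivative_diff[OF _ has_derivative_const[of p]] by fastforce
  ultimately have "frechet_derivative (nil_mult J (- p)) (at p) =
      (\<lambda>q. q - (1/2) *\<^sub>R lie_bracket J p q)"
    by (metis frechet_derivative_at)
  then show ?thesis
    by (simp add: left_inv_metric_def)
qed

lemma metric_two_step_nilpotent_sigma_deform:
  fixes J :: "'z::euclidean_space \<Rightarrow> 'v::euclidean_space \<Rightarrow> 'v"
  assumes "metric_two_step_nilpotent J" "orthogonal_transformation \<sigma>" "\<sigma> \<circ> \<sigma> = id"
    and "\<And>Z. \<sigma> \<circ> J Z = J Z \<circ> \<sigma>"
  shows "metric_two_step_nilpotent (sigma_deform \<sigma> J)"
proof -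
  have lin: "linear \<sigma>" and iso: "\<And>x y. \<sigma> x \<bullet> \<sigma> y = x \<bullet> y" and inv: "\<And>x. \<sigma> (\<sigma> x) = x"
    and comm: "\<And>Z X. \<sigma> (J Z X) = J Z (\<sigma> X)"
    using assms by (auto simp: orthogonal_transformation_def fun_eq_iff)
  have symm: "\<sigma> x \<bullet> y = x \<bullet> \<sigma> y" for x y
    by (metis iso inv)
  have br: "lie_bracket (sigma_deform \<sigma> J) p q = lie_bracket J p (\<sigma> (fst q), snd q)" for p q
    by (simp add: lie_bracket_def sigma_deform_def symm)
  have q: "q = (\<sigma> (fst (\<sigma> (fst q), snd q)), snd (\<sigma> (fst q), snd q))" for q :: "'v \<times> 'z"
    by (simp add: inv)
  have "{lie_bracket (sigma_deform \<sigma> J) p q | p q. True} = {lie_bracket J p q | p q. True}"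
    unfolding br using q by (auto, metis)
  moreover have "(\<forall>q. lie_bracket (sigma_deform \<sigma> J) p q = 0) \<longleftrightarrow> (\<forall>q. lie_bracket J p q = 0)" for p
    unfolding br using q by metis
  moreover have "inj (sigma_deform \<sigma> J)"
  proof (rule injI)
    fix Z Z' assume "sigma_deform \<sigma> J Z = sigma_deform \<sigma> J Z'"
    then have "J Z X = J Z' X" for X
      unfolding sigma_deform_def by (metis comp_apply inv)
    then show "Z = Z'"
      using assms(1) by (auto simp: metric_two_step_nilpotent_def inj_def fun_eq_iff)
  qed
  moreover have "linear (sigma_deform \<sigma> J Z)" "linear (\<lambda>Z. sigma_deform \<sigma> J Z X)" for Z X
    using assms(1) lin linear_compose[OF _ lin, of "\<lambda>Z. J Z X"]
    by (auto simp: sigma_deform_def metric_two_step_nilpotent_def o_def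
        intro: linear_compose[unfolded o_def])
  moreover have "sigma_deform \<sigma> J Z X \<bullet> Y = - (X \<bullet> sigma_deform \<sigma> J Z Y)" for Z X Y
    using assms(1) by (simp add: sigma_deform_def metric_two_step_nilpotent_def symm comm)
  ultimately show ?thesis
    using assms(1) by (simp add: metric_two_step_nilpotent_def)
qed

end

theory Submission
  imports Defs
begin

text \<open>
  Translations along the fibre torus are isometries for both metrics, so functions can be split into
  Fourier modes along the fibre, one for each pair of opposite vectors \<open>\<plusminus>\<gamma>\<close> of the dual lattice.
  In the left-invariant orthonormal frame the Laplacian is the sum of the second derivatives along
  the frame fields (\<open>laplacian_left_inv_metric\<close>), and the frames of the two algebras differ only by
  vertical vectors. A vertical vector \<open>W\<close> acts on mode \<open>\<gamma>\<close> only through \<open>\<gamma> \<bullet> W\<close>, so the bracket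
  enters the Laplacian of that mode only through the single skew map \<open>J \<gamma>\<close>, respectively
  \<open>\<sigma> \<circ> J \<gamma>\<close>.

  These two maps are orthogonally conjugate: \<open>J \<gamma> \<circ> R = R \<circ> \<sigma> \<circ> J \<gamma>\<close> holds for the map \<open>R\<close> that is
  the identity on the fixed space of \<open>\<sigma>\<close> and that on the \<open>-1\<close> eigenspace conjugates \<open>J \<gamma>\<close> into its
  negative, which is possible for every skew map (\<open>exists_orthogonal_intertwiner\<close>). Rotating
  the base by \<open>R\<close> therefore carries an eigenfunction of mode \<open>\<gamma>\<close> for \<open>J\<close> to one for the deformed
  algebra (\<open>laplacian_sigma_deform_compose\<close>). A rotation preserves the ball and its boundary, and the
  boundary normal is radial for both metrics (\<open>boundary_normal_left_inv_metric_iff\<close>), so both boundary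
  conditions are respected.

  The rotation depends on the mode, so the modes have to be put together again. This needs no
  convergent series. Multiplicities are suprema over finite independent sets, and on the span of a
  finite set finitely many modes already separate functions; the sum of the corresponding finitely
  many rotated modes is then an injective linear map into the other eigenspace
  (\<open>multiplicity_of_le\<close>). Two facts on Fourier series enter: a continuous periodic
  function with vanishing coefficients is zero (\<open>fourier_coefficients_zero_imp_zero\<close>), and modes of
  essentially different frequencies are independent (\<open>trigonometric_modes_independent\<close>). The opposite
  inequality between multiplicities is the same statement for the deformed algebra, because
  deforming twice gives back \<open>J\<close>.
\<close>

section \<open>The Gram determinant of a pulled-back inner product\<close>

text \<open>
  The multiplicativity of determinants is known for matrices indexed by a finite type, while Gram
  determinants are sums over permutations of the basis set. Turning the basis into a type
  makes the former available.
\<close>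

typedef (overloaded) 'a basis_index = "Basis :: 'a::euclidean_space set"
  using nonempty_Basis by blast

instance basis_index :: (euclidean_space) finite
proof
  have "finite (Rep_basis_index ` (UNIV :: 'a basis_index set))"
    using finite_subset[OF _ finite_Basis] Rep_basis_index by blast
  then show "finite (UNIV :: 'a basis_index set)"
    by (rule finite_imageD) (simp add: Rep_basis_index_inject inj_on_def)
qed

lemma bij_betw_Rep_basis_index: "bij_betw Rep_basis_index UNIV Basis"
  using type_definition.Rep_range[OF type_definition_basis_index]
  by (auto simp: bij_betw_def inj_on_def Rep_basis_index_inject)

lemma gram_det_eq_det:
  "gram_det g p = det (\<chi> i j. g p (Rep_basis_index i) (Rep_basis_index j))"
proof -
  let ?f = "Rep_basis_index :: 'a basis_index \<Rightarrow> 'a"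
  let ?m = "map_permutation UNIV ?f"
  have inj: "inj ?f" and img: "?f ` UNIV = Basis"
    using bij_betw_Rep_basis_index by (auto simp: bij_betw_def)
  have app: "?m q (?f i) = ?f (q i)" for q i
    using inj by (simp add: map_permutation_apply)
  have bij: "bij_betw ?m {q. q permutes UNIV} {\<pi>. \<pi> permutes Basis}"
    unfolding bij_betw_def
  proof
    show "inj_on ?m {q. q permutes UNIV}"
      by (rule inj_onI) (metis app ext Rep_basis_index_inject)
    have "\<pi> \<in> ?m ` {q. q permutes UNIV}" if "\<pi> permutes Basis" for \<pi>
    proof -
      let ?q = "map_permutation Basis (inv ?f) \<pi>"
      have b: "bij_betw (inv ?f) Basis UNIV"
        by (metis bij_betw_Rep_basis_index bij_betw_inv_into)
      have "?m ?q = \<pi>"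
        by (rule map_permutation_compose_inv[OF b that])
          (metis img f_inv_into_f)
      then show ?thesis
        using map_permutation_permutes[OF b that] by (metis image_eqI mem_Collect_eq)
    qed
    then show "?m ` {q. q permutes UNIV} = {\<pi>. \<pi> permutes Basis}"
      using map_permutation_permutes[OF bij_betw_Rep_basis_index] by auto
  qed
  have "(\<Prod>b\<in>Basis. g p b (?m q b)) = (\<Prod>i\<in>UNIV. g p (?f i) (?f (q i)))" for q
    using prod.reindex_bij_betw[OF bij_betw_Rep_basis_index, of "\<lambda>b. g p b (?m q b)"]
    by (simp add: app)
  then have "gram_det g p = (\<Sum>q | q permutes UNIV.
      of_int (sign q) * (\<Prod>i\<in>UNIV. g p (?f i) (?f (q i))))"
    unfolding gram_det_def
    using sum.reindex_bij_betw[OF bij,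
        of "\<lambda>\<pi>. of_int (sign \<pi>) * (\<Prod>b\<in>Basis. g p b (\<pi> b))"]
    by (simp add: sign_map_permutation[OF inj])
  then show ?thesis
    by (simp add: det_def)
qed

definition basis_matrix ::
  "('a::euclidean_space \<Rightarrow> 'a) \<Rightarrow> real ^ 'a basis_index ^ 'a basis_index" where
  "basis_matrix f = (\<chi> i j. f (Rep_basis_index j) \<bullet> Rep_basis_index i)"

lemma sum_basis_index:
  "(\<Sum>k\<in>UNIV. h (Rep_basis_index k)) = (\<Sum>b\<in>(Basis :: 'a::euclidean_space set). h b)"
  using sum.reindex_bij_betw[OF bij_betw_Rep_basis_index] by blast

lemma basis_matrix_compose:
  assumes "linear f"
  shows "basis_matrix (f \<circ> g) = basis_matrix f ** basis_matrix g"
proof -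
  have "f (g x) \<bullet> y = (\<Sum>b\<in>Basis. (f b \<bullet> y) * (g x \<bullet> b))" for x y
  proof -
    have "f (g x) = f (\<Sum>b\<in>Basis. (g x \<bullet> b) *\<^sub>R b)"
      by (simp add: euclidean_representation)
    then show ?thesis
      by (simp add: linear_sum[OF assms] linear_cmul[OF assms] inner_sum_left mult.commute)
  qed
  then show ?thesis
    by (simp add: basis_matrix_def matrix_matrix_mult_def vec_eq_iff
        flip: sum_basis_index)
qed

lemma basis_matrix_id: "basis_matrix id = mat 1"
  by (simp add: basis_matrix_def mat_def vec_eq_iff inner_Basis Rep_basis_index
      Rep_basis_index_inject eq_commute)

text \<open>
  The Gram matrix of the pullback along \<open>A\<close> has determinant \<open>(det A)\<^sup>2\<close>. If an involution \<open>C\<close>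
  conjugates \<open>A\<close> into its inverse, then \<open>det A = 1 / det A\<close>. For the unipotent maps below this avoids
  ordering the basis so that \<open>A\<close> becomes triangular.
\<close>

lemma gram_det_pullback_eq_1:
  fixes A B C :: "'a::euclidean_space \<Rightarrow> 'a"
  assumes g: "\<And>u w. g p u w = A u \<bullet> A w"
    and lin: "linear A" "linear C"
    and conj: "A \<circ> (C \<circ> (A \<circ> C)) = id" and invol: "C \<circ> C = id"
  shows "gram_det g p = 1"
proof -
  have "det (basis_matrix A) * (det (basis_matrix C) * (det (basis_matrix A) * det (basis_matrix C))) = 1"
    using conj lin basis_matrix_id
    by (metis basis_matrix_compose det_I det_mul)
  moreover have "det (basis_matrix C) * det (basis_matrix C) = 1"
    using invol lin basis_matrix_id
    by (metis basis_matrix_compose det_I det_mul)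
  ultimately have "det (basis_matrix A) * det (basis_matrix A) = 1"
    by (metis mult.assoc mult.commute mult.right_neutral)
  moreover have "(\<chi> i j. g p (Rep_basis_index i) (Rep_basis_index j)) =
      transpose (basis_matrix A) ** basis_matrix A"
    using euclidean_inner[of "A (Rep_basis_index _)" "A (Rep_basis_index _)"]
    by (simp add: g basis_matrix_def matrix_matrix_mult_def transpose_def vec_eq_iff
        sum_basis_index[of "\<lambda>b. (A _ \<bullet> b) * (A _ \<bullet> b)"])
  ultimately show ?thesis
    by (simp add: gram_det_eq_det det_mul)
qed


section \<open>Orthogonal intertwiners of skew maps\<close>

lemma exists_max_image_on_unit_sphere:
  fixes V :: "'v::euclidean_space set"
  assumes V: "subspace V" "V \<noteq> {0}" and K: "linear K"
  obtains x where "x \<in> V" "norm x = 1" "\<And>y. y \<in> V \<Longrightarrow> norm (K y) \<le> norm (K x) * norm y"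
proof -
  obtain v where v: "v \<in> V" "v \<noteq> 0"
    using V subspace_0 by blast
  then have "(1 / norm v) *\<^sub>R v \<in> sphere 0 1 \<inter> V"
    using V(1) by (auto simp: subspace_scale)
  moreover have "compact (sphere 0 1 \<inter> V)"
    by (intro compact_Int_closed compact_sphere closed_subspace V)
  moreover have "continuous_on (sphere 0 1 \<inter> V) (\<lambda>x. norm (K x))"
    using K by (intro continuous_on_norm linear_continuous_on) (simp add: linear_conv_bounded_linear)
  ultimately obtain x where x: "x \<in> sphere 0 1 \<inter> V"
    and max: "\<And>y. y \<in> sphere 0 1 \<inter> V \<Longrightarrow> norm (K y) \<le> norm (K x)"
    using continuous_attains_sup by (metis empty_iff)
  have "norm (K y) \<le> norm (K x) * norm y" if "y \<in> V" for y
  proof (cases "y = 0")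
    case False
    have "norm (K ((1 / norm y) *\<^sub>R y)) \<le> norm (K x)"
      using False V(1) that by (intro max) (auto simp: subspace_scale)
    then show ?thesis
      using False by (simp add: linear_cmul[OF K] field_simps)
  qed (use K in \<open>simp add: linear_0\<close>)
  with x show ?thesis
    by (intro that[of x]) auto
qed

text \<open>
  First-order optimality at a maximizer \<open>x\<close> of \<open>norm (K x)\<close> on the unit sphere of \<open>V\<close>. It says that \<open>x\<close>
  is an eigenvector of the quadratic form \<open>(norm (K x))\<^sup>2\<close> on \<open>V\<close>.
\<close>

lemma maximizer_orthogonal_images:
  fixes K :: "'v::euclidean_space \<Rightarrow> 'v"
  assumes V: "subspace V" and K: "linear K"
    and x: "x \<in> V" "norm x = 1" and max: "\<And>y. y \<in> V \<Longrightarrow> norm (K y) \<le> norm (K x) * norm y"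
    and y: "y \<in> V" "y \<bullet> x = 0"
  shows "K x \<bullet> K y = 0"
proof -
  define a c d where "a = K x \<bullet> K y" and "c = K x \<bullet> K x" and "d = y \<bullet> y"
  have le: "2 * t * a \<le> t\<^sup>2 * (c * d)" for t
  proof -
    have "norm (K (x + t *\<^sub>R y)) ^ 2 \<le> (norm (K x) * norm (x + t *\<^sub>R y)) ^ 2"
      using V x(1) y(1) by (intro power_mono max) (auto simp: subspace_add subspace_scale)
    moreover have "norm (K (x + t *\<^sub>R y)) ^ 2 = c + 2 * t * a + t\<^sup>2 * (K y \<bullet> K y)"
      by (simp add: linear_add[OF K] linear_cmul[OF K] power2_norm_eq_inner[unfolded power2_eq_square] a_def c_def
          inner_add_left inner_add_right inner_commute power2_eq_square)
    moreover have "norm (x + t *\<^sub>R y) ^ 2 = 1 + t\<^sup>2 * d"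
      using x(2) y(2)
      by (simp add: power2_norm_eq_inner[unfolded power2_eq_square] d_def inner_add_left
          inner_add_right inner_commute power2_eq_square norm_eq_1)
    moreover have "norm (K x) ^ 2 = c"
      by (simp add: c_def power2_norm_eq_inner)
    ultimately have "c + 2 * t * a + t\<^sup>2 * (K y \<bullet> K y) \<le> c * (1 + t\<^sup>2 * d)"
      by (simp add: power_mult_distrib)
    moreover have "c * (1 + t\<^sup>2 * d) = c + t\<^sup>2 * (c * d)"
      by (simp add: algebra_simps)
    moreover have "0 \<le> t\<^sup>2 * (K y \<bullet> K y)"
      by simp
    ultimately show ?thesis
      by linarith
  qed
  have cd: "0 \<le> c * d"
    by (simp add: c_def d_def)
  \<comment> \<open>For small \<open>t\<close> the linear term wins; the choice \<open>t = a / (c * d + 1)\<close> is small enough.\<close>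
  have "2 * a\<^sup>2 * (c * d + 1) \<le> a\<^sup>2 * (c * d)"
  proof -
    define e where "e = c * d + 1"
    have e: "0 < e" using cd by (simp add: e_def)
    have "2 * (a / e) * a * e\<^sup>2 \<le> (a / e)\<^sup>2 * (c * d) * e\<^sup>2"
      using le[of "a / e"] by (intro mult_right_mono) auto
    moreover have "2 * (a / e) * a * e\<^sup>2 = 2 * a\<^sup>2 * e"
      using e by (simp add: power2_eq_square)
    moreover have "(a / e)\<^sup>2 * (c * d) * e\<^sup>2 = a\<^sup>2 * (c * d)"
      using e by (simp add: power_divide)
    ultimately show ?thesis unfolding e_def by metis
  qed
  then have "a\<^sup>2 * (c * d + 2) \<le> 0"
    by (simp add: algebra_simps)
  then show ?thesis
    using cd by (simp add: a_def mult_le_0_iff)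
qed

text \<open>
  For \<open>v = 0\<close> this is the identity because of division by zero, which is the right value below,
  where \<open>v = K x\<close> may vanish.
\<close>

definition hyperplane_reflection :: "'v::real_inner \<Rightarrow> 'v \<Rightarrow> 'v" where
  "hyperplane_reflection v y = y - (2 * (y \<bullet> v) / (v \<bullet> v)) *\<^sub>R v"

lemma orthogonal_transformation_hyperplane_reflection:
  "orthogonal_transformation (hyperplane_reflection v)"
  unfolding orthogonal_transformation_def
proof (intro conjI allI)
  show "linear (hyperplane_reflection v)"
    by (rule linearI) (simp_all add: hyperplane_reflection_def algebra_simps add_divide_distrib)
  show "hyperplane_reflection v x \<bullet> hyperplane_reflection v y = x \<bullet> y" for x y
    by (cases "v = 0")
      (simp_all add: hyperplane_reflection_def algebra_simps inner_commute)
qed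

lemma hyperplane_reflection_orthogonal: "y \<bullet> v = 0 \<Longrightarrow> hyperplane_reflection v y = y"
  by (simp add: hyperplane_reflection_def)

lemma hyperplane_reflection_self: "hyperplane_reflection v v = - v"
  by (cases "v = 0") (simp_all add: hyperplane_reflection_def scaleR_2)

text \<open>
  The space \<open>V\<close> splits orthogonally into planes spanned by some \<open>x\<close> and \<open>K x\<close>, on which the skew map
  \<open>K\<close> is a multiple of a rotation by a right angle, and the part of the kernel of \<open>K\<close> in \<open>V\<close>.
  Reflecting each plane in the line of \<open>x\<close> reverses the rotation. The induction splits off one plane, taking \<open>x\<close> to be a maximizer of \<open>norm (K x)\<close>; the
  map is the composition of the reflections along the vectors \<open>K x\<close>, so it fixes everything
  orthogonal to \<open>V\<close>.
\<close>

lemma exists_orthogonal_anticommuting: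
  fixes K :: "'v::euclidean_space \<Rightarrow> 'v"
  assumes K: "linear K" and skew: "\<And>x y. K x \<bullet> y = - (x \<bullet> K y)"
    and V: "subspace V" "K ` V \<subseteq> V"
  shows "\<exists>R. orthogonal_transformation R \<and> (\<forall>y. (\<forall>v\<in>V. y \<bullet> v = 0) \<longrightarrow> R y = y) \<and>
    (\<forall>y\<in>V. K (R y) = - R (K y))"
  using V
proof (induction "dim V" arbitrary: V rule: less_induct)
  case less
  show ?case
  proof (cases "V = {0}")
    case True
    then show ?thesis
      using linear_0[OF K] by (intro exI[of _ id]) (auto simp: orthogonal_transformation_id[unfolded id_def] id_def)
  next
    case False
    then obtain x where x: "x \<in> V" "norm x = 1"
      and max: "\<And>y. y \<in> V \<Longrightarrow> norm (K y) \<le> norm (K x) * norm y"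
      using exists_max_image_on_unit_sphere[OF less.prems(1) _ K] by blast
    have orth: "K x \<bullet> K y = 0" if "y \<in> V" "y \<bullet> x = 0" for y
      using maximizer_orthogonal_images[OF less.prems(1) K x max that] by blast
    have Kx: "K x \<in> V" "K x \<bullet> x = 0" "x \<bullet> K x = 0"
      using less.prems(2) x(1) skew[of x x] by (auto simp: inner_commute)
    define V' where "V' = {y \<in> V. y \<bullet> x = 0 \<and> y \<bullet> K x = 0}"
    have V': "subspace V'"
      using less.prems(1) by (auto simp: V'_def subspace_def inner_add_left)
    have KV': "K ` V' \<subseteq> V'"
    proof (rule image_subsetI)
      fix y assume "y \<in> V'"
      then have y: "y \<in> V" "y \<bullet> x = 0" "y \<bullet> K x = 0"
        by (auto simp: V'_def)
      have "K y \<bullet> x = 0" "K y \<bullet> K x = 0"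
        using skew[of y x] y(3) orth[OF y(1,2)] by (simp_all add: inner_commute)
      with y(1) less.prems(2) show "K y \<in> V'"
        by (auto simp: V'_def)
    qed
    have "x \<notin> V'"
      using x(2) by (auto simp: V'_def norm_eq_1)
    moreover have "V' \<subseteq> V"
      by (auto simp: V'_def)
    ultimately have "span V' \<subset> span V"
      using x(1) V' less.prems(1) by (metis psubsetI span_eq_iff)
    then have "dim V' < dim V"
      by (rule dim_psubset)
    then obtain R where R: "orthogonal_transformation R"
      and fix': "\<And>y. (\<forall>v\<in>V'. y \<bullet> v = 0) \<Longrightarrow> R y = y"
      and anti: "\<And>y. y \<in> V' \<Longrightarrow> K (R y) = - R (K y)"
      using less.hyps[OF _ V' KV'] by blast
    note linR = orthogonal_transformation_linear[OF R]
    let ?\<rho> = "hyperplane_reflection (K x)"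
    have lin\<rho>: "linear ?\<rho>"
      by (simp add: orthogonal_transformation_hyperplane_reflection orthogonal_transformation_linear)
    have Rx: "R x = x" and RKx: "R (K x) = K x"
      by (auto intro!: fix' simp: V'_def inner_commute)
    \<comment> \<open>The residual vector lies in \<open>V\<close> and is orthogonal to \<open>x\<close>, hence by maximality to \<open>K (K x)\<close>,
      and so to itself.\<close>
    have KKx: "K (K x) = - (K x \<bullet> K x) *\<^sub>R x"
    proof -
      let ?r = "K (K x) + (K x \<bullet> K x) *\<^sub>R x"
      have "?r \<in> V"
        using less.prems x(1) Kx(1) by (auto simp: subspace_add subspace_scale)
      moreover have rx: "?r \<bullet> x = 0"
        using x(2) by (simp add: inner_add_left skew[of "K x"] norm_eq_1)
      ultimately have "K x \<bullet> K ?r = 0"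
        by (rule orth)
      then have "K (K x) \<bullet> ?r = 0"
        by (simp add: skew)
      then have "?r \<bullet> ?r = 0"
        using rx inner_add_left[of "K (K x)" "(K x \<bullet> K x) *\<^sub>R x" ?r]
        by (simp add: inner_commute[of x])
      then show ?thesis
        by (simp add: eq_neg_iff_add_eq_0)
    qed
    show ?thesis
    proof (intro exI[of _ "R \<circ> ?\<rho>"] conjI allI ballI impI)
      show "orthogonal_transformation (R \<circ> ?\<rho>)"
        by (rule orthogonal_transformation_compose[OF R orthogonal_transformation_hyperplane_reflection])
      show "(R \<circ> ?\<rho>) y = y" if "\<forall>v\<in>V. y \<bullet> v = 0" for y
        using that Kx(1) fix' by (simp add: hyperplane_reflection_orthogonal V'_def)
      fix y assume y: "y \<in> V"
      define a s y' where "a = y \<bullet> x" and "s = (y \<bullet> K x) / (K x \<bullet> K x)"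
        and "y' = y - a *\<^sub>R x - s *\<^sub>R K x"
      have "y' \<in> V"
        unfolding y'_def using y x(1) Kx(1) less.prems(1) by (intro subspace_diff subspace_scale)
      moreover have "y' \<bullet> x = 0" "y' \<bullet> K x = 0"
        using x(2) Kx(2,3) by (simp_all add: y'_def a_def s_def inner_diff_left norm_eq_1)
      ultimately have y': "y' \<in> V'"
        by (simp add: V'_def)
      then have Ky': "K y' \<in> V'"
        using KV' by blast
      have \<rho>: "?\<rho> x = x" "?\<rho> (K x) = - K x" "?\<rho> y' = y'" "?\<rho> (K y') = K y'"
        using Kx(3) y' Ky' unfolding V'_def
        by (simp_all only: hyperplane_reflection_orthogonal hyperplane_reflection_self mem_Collect_eq)
      have y_eq: "y = a *\<^sub>R x + s *\<^sub>R K x + y'"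
        by (simp add: y'_def)
      have "(R \<circ> ?\<rho>) y = a *\<^sub>R x - s *\<^sub>R K x + R y'"
        by (simp add: y_eq \<rho> Rx RKx linear_add[OF lin\<rho>] linear_cmul[OF lin\<rho>] linear_add[OF linR]
            linear_cmul[OF linR] linear_diff[OF linR])
      then have "K ((R \<circ> ?\<rho>) y) = a *\<^sub>R K x - s *\<^sub>R K (K x) - R (K y')"
        by (simp add: linear_add[OF K] linear_diff[OF K] linear_cmul[OF K] anti[OF y'])
      moreover have "?\<rho> (K y) = - (a *\<^sub>R K x) + s *\<^sub>R K (K x) + K y'"
        by (simp add: y_eq \<rho> KKx linear_add[OF lin\<rho>] linear_cmul[OF lin\<rho>] linear_neg[OF lin\<rho>]
            linear_diff[OF lin\<rho>] linear_add[OF K] linear_cmul[OF K])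
      then have "R (?\<rho> (K y)) = - (a *\<^sub>R K x) + s *\<^sub>R K (K x) + R (K y')"
        by (simp add: KKx Rx RKx linear_add[OF linR] linear_diff[OF linR] linear_cmul[OF linR]
            linear_neg[OF linR])
      ultimately show "K ((R \<circ> ?\<rho>) y) = - (R \<circ> ?\<rho>) (K y)"
        by simp
    qed
  qed
qed

text \<open>
  On the fixed space of \<open>\<sigma>\<close> the maps \<open>K\<close> and \<open>\<sigma> \<circ> K\<close> agree and on its orthogonal complement, the
  \<open>-1\<close> eigenspace, they are negatives of each other. So it suffices to reverse the sign of \<open>K\<close> on the
  latter by a map that fixes the former.
\<close>

lemma exists_orthogonal_intertwiner:
  fixes K :: "'v::euclidean_space \<Rightarrow> 'v"
  assumes K: "linear K" and skew: "\<And>x y. K x \<bullet> y = - (x \<bullet> K y)"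
    and \<sigma>: "orthogonal_transformation \<sigma>" "\<And>x. \<sigma> (\<sigma> x) = x" and comm: "\<And>x. \<sigma> (K x) = K (\<sigma> x)"
  shows "\<exists>R. orthogonal_transformation R \<and> (\<forall>x. K (R x) = R (\<sigma> (K x)))"
proof -
  note lin\<sigma> = orthogonal_transformation_linear[OF \<sigma>(1)]
  define V where "V = {x. \<sigma> x = - x}"
  have V: "subspace V"
    by (auto simp: V_def subspace_def linear_0[OF lin\<sigma>] linear_add[OF lin\<sigma>] linear_cmul[OF lin\<sigma>])
  have KV: "K ` V \<subseteq> V"
    by (auto simp: V_def comm linear_neg[OF K])
  from exists_orthogonal_anticommuting[OF K skew V KV] obtain R where R: "orthogonal_transformation R"
    and fix': "\<And>y. (\<forall>v\<in>V. y \<bullet> v = 0) \<Longrightarrow> R y = y"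
    and anti: "\<And>y. y \<in> V \<Longrightarrow> K (R y) = - R (K y)"
    by blast
  note linR = orthogonal_transformation_linear[OF R]
  have fixed: "R y = y" if "\<sigma> y = y" for y
  proof (rule fix', intro ballI)
    fix v assume "v \<in> V"
    then have "y \<bullet> v = - (y \<bullet> v)"
      using \<sigma>(1) that unfolding V_def orthogonal_transformation_def
      by (metis (mono_tags) inner_minus_right mem_Collect_eq)
    then show "y \<bullet> v = 0" by simp
  qed
  have "K (R x) = R (\<sigma> (K x))" for x
  proof -
    define p m where "p = (1/2) *\<^sub>R (x + \<sigma> x)" and "m = (1/2) *\<^sub>R (x - \<sigma> x)"
    have x: "x = p + m"
      by (simp add: p_def m_def algebra_simps flip: scaleR_add_left)
    have p: "\<sigma> p = p" and m: "\<sigma> m = - m"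
      by (simp_all add: p_def m_def linear_cmul[OF lin\<sigma>] linear_add[OF lin\<sigma>] linear_diff[OF lin\<sigma>] \<sigma>(2)
          algebra_simps)
    have "K (R x) = K p - R (K m)"
      using anti[of m] m p by (simp add: x linear_add[OF linR] linear_add[OF K] fixed V_def)
    also have "\<dots> = R (\<sigma> (K x))"
      using fixed[of "K p"] p m
      by (simp add: x linear_add[OF linR] linear_add[OF K] linear_add[OF lin\<sigma>] comm linear_neg[OF K]
          linear_diff[OF linR])
    finally show ?thesis .
  qed
  with R show ?thesis by blast
qed


section \<open>Smooth functions, directional derivatives and averages of translates\<close>

abbreviation dderiv :: "('a::real_normed_vector \<Rightarrow> real) \<Rightarrow> 'a \<Rightarrow> 'a \<Rightarrow> real" where
  "dderiv f u \<equiv> \<lambda>x. frechet_derivative f (at x) u"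

lemma smooth_fun_dderiv_Basis:
  assumes "smooth_fun f" "b \<in> Basis" shows "smooth_fun (dderiv f b)"
  unfolding smooth_fun_def
proof
  fix k
  have "times_cont_diff (Suc k) f"
    using assms(1) by (simp only: smooth_fun_def)
  then show "times_cont_diff k (dderiv f b)"
    using assms(2) by simp
qed

lemma smooth_fun_differentiable:
  assumes "smooth_fun f" shows "f differentiable (at x)"
proof -
  have "times_cont_diff (Suc 0) f"
    using assms by (simp only: smooth_fun_def)
  then show ?thesis by simp
qed

lemma times_cont_diff_imp_continuous: "times_cont_diff k f \<Longrightarrow> continuous_on UNIV f"
  by (cases k)
    (simp_all add: continuous_on_eq_continuous_within differentiable_imp_continuous_within)

lemma smooth_fun_continuous: "smooth_fun f \<Longrightarrow> continuous_on S f"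
  using times_cont_diff_imp_continuous[of 0 f] continuous_on_subset[of UNIV f S]
  by (simp add: smooth_fun_def)

lemma has_derivative_frechet:
  "f differentiable (at x) \<Longrightarrow> (f has_derivative frechet_derivative f (at x)) (at x)"
  by (simp add: frechet_derivative_works)

lemma dderiv_eqI: "(f has_derivative f') (at x) \<Longrightarrow> dderiv f u x = f' u"
  by (metis frechet_derivative_at)

text \<open>
  Smoothness is phrased in terms of basis directions only; this identity extends it to all
  directions.
\<close>

lemma dderiv_sum_Basis:
  assumes "f differentiable (at x)"
  shows "dderiv f u x = (\<Sum>b\<in>Basis. (u \<bullet> b) * dderiv f b x)"
proof -
  have lin: "linear (\<lambda>u. dderiv f u x)"
    using assms by (rule linear_frechet_derivative)
  have "dderiv f u x = dderiv f (\<Sum>b\<in>Basis. (u \<bullet> b) *\<^sub>R b) x"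
    by (simp add: euclidean_representation)
  then show ?thesis
    by (simp only: linear_sum[OF lin] linear_cmul[OF lin] real_scaleR_def)
qed

lemma dderiv_add:
  assumes "\<And>x. f differentiable (at x)" "\<And>x. g differentiable (at x)"
  shows "dderiv (\<lambda>x. f x + g x) u = (\<lambda>x. dderiv f u x + dderiv g u x)"
  by (rule ext, rule dderiv_eqI) (intro has_derivative_add has_derivative_frechet assms)

lemma dderiv_cmult:
  fixes c :: real
  assumes "\<And>x. f differentiable (at x)"
  shows "dderiv (\<lambda>x. c * f x) u = (\<lambda>x. c * dderiv f u x)"
  by (rule ext, rule dderiv_eqI) (intro has_derivative_mult_right has_derivative_frechet assms)

lemma times_cont_diff_const: "times_cont_diff k (\<lambda>x. c)"
  by (induction k arbitrary: c) auto

lemma times_cont_diff_add: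
  "times_cont_diff k f \<Longrightarrow> times_cont_diff k g \<Longrightarrow> times_cont_diff k (\<lambda>x. f x + g x)"
  by (induction k arbitrary: f g) (auto simp: dderiv_add intro: continuous_on_add)

lemma times_cont_diff_cmult:
  fixes c :: real
  shows "times_cont_diff k f \<Longrightarrow> times_cont_diff k (\<lambda>x. c * f x)"
  by (induction k arbitrary: f) (auto simp: dderiv_cmult intro: continuous_on_mult_left)

lemma times_cont_diff_sum:
  "(\<And>i. i \<in> I \<Longrightarrow> times_cont_diff k (f i)) \<Longrightarrow> times_cont_diff k (\<lambda>x. \<Sum>i\<in>I. f i x)"
  by (induction I rule: infinite_finite_induct)
    (auto simp: times_cont_diff_const intro: times_cont_diff_add)

lemma smooth_fun_add: "smooth_fun f \<Longrightarrow> smooth_fun g \<Longrightarrow> smooth_fun (\<lambda>x. f x + g x)"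
  by (simp add: smooth_fun_def times_cont_diff_add)

lemma smooth_fun_const: "smooth_fun (\<lambda>x. c)"
  by (simp add: smooth_fun_def times_cont_diff_const)

lemma smooth_fun_dderiv:
  assumes "smooth_fun f" shows "smooth_fun (dderiv f u)"
proof -
  have "dderiv f u = (\<lambda>x. \<Sum>b\<in>Basis. (u \<bullet> b) * dderiv f b x)"
    by (rule ext, rule dderiv_sum_Basis, rule smooth_fun_differentiable, rule assms)
  then show ?thesis
    using smooth_fun_dderiv_Basis[OF assms]
    by (simp add: smooth_fun_def times_cont_diff_sum times_cont_diff_cmult)
qed

lemma dderiv_compose_linear:
  fixes M :: "'a::euclidean_space \<Rightarrow> 'b::euclidean_space"
  assumes "\<And>x. f differentiable (at x)" and "linear M"
  shows "dderiv (\<lambda>x. f (M x)) u = (\<lambda>x. dderiv f (M u) (M x))"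
proof (rule ext, rule dderiv_eqI)
  fix x
  have "bounded_linear M"
    using assms(2) by (simp add: linear_conv_bounded_linear)
  from has_derivative_compose[OF bounded_linear_imp_has_derivative[OF this]
      has_derivative_frechet[OF assms(1)]]
  show "((\<lambda>x. f (M x)) has_derivative (\<lambda>u. dderiv f (M u) (M x))) (at x)" .
qed

lemma times_cont_diff_compose_linear:
  assumes "linear M"
  shows "times_cont_diff k f \<Longrightarrow> times_cont_diff k (\<lambda>x. f (M x))"
proof (induction k arbitrary: f)
  case 0
  then show ?case
    using assms linear_continuous_on[of M UNIV]
    by (auto simp: linear_conv_bounded_linear intro: continuous_on_compose2)
next
  case (Suc k)
  have diff: "f differentiable (at x)" for x
    using Suc.prems by simp
  have "M differentiable (at x)" for x
    using assms by (rule linear_imp_differentiable)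
  then have "(\<lambda>x. f (M x)) differentiable (at x)" for x
    using differentiable_chain_at[of M x f] diff by (simp add: o_def)
  moreover have "times_cont_diff k (dderiv (\<lambda>x. f (M x)) b)" if "b \<in> Basis" for b
  proof -
    have "dderiv (\<lambda>x. f (M x)) b = (\<lambda>x. \<Sum>c\<in>Basis. (M b \<bullet> c) * dderiv f c (M x))"
      using dderiv_compose_linear[OF diff assms] dderiv_sum_Basis[OF diff, where u = "M b"] by simp
    then show ?thesis
      unfolding \<open>dderiv _ b = _\<close>
      using Suc.IH[of "dderiv f _"] Suc.prems
      by (intro times_cont_diff_sum times_cont_diff_cmult) simp
  qed
  ultimately show ?case
    by simp
qed

lemma smooth_fun_compose_linear: "linear M \<Longrightarrow> smooth_fun f \<Longrightarrow> smooth_fun (\<lambda>x. f (M x))"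
  by (simp add: smooth_fun_def times_cont_diff_compose_linear)

text \<open>
  Averages of translates of \<open>f\<close> against a weight. The Fourier modes of \<open>f\<close> have this form, and in this
  form all derivatives fall on \<open>f\<close> alone.
\<close>

definition translate_average :: "('t::euclidean_space \<Rightarrow> 'a::euclidean_space) \<Rightarrow> ('t \<Rightarrow> real) \<Rightarrow> ('a \<Rightarrow> real) \<Rightarrow> 'a \<Rightarrow> real" where
  "translate_average h w f p = integral (cbox 0 One) (\<lambda>t. w t * f (p + h t))"

context
  fixes h :: "'t::euclidean_space \<Rightarrow> 'a::euclidean_space" and w :: "'t \<Rightarrow> real"
  assumes h: "continuous_on UNIV h" and w: "continuous_on UNIV w"
begin

lemma continuous_on_translate_integrand:
  assumes "continuous_on UNIV f"
  shows "continuous_on S (\<lambda>(p, t). w t * f (p + h t))"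
proof -
  have ws: "continuous_on S (\<lambda>x. w (snd x))" and hs: "continuous_on S (\<lambda>x. h (snd x))"
    by (rule continuous_on_compose2[OF w continuous_on_snd[OF continuous_on_id]], simp,
        rule continuous_on_compose2[OF h continuous_on_snd[OF continuous_on_id]], simp)
  have "continuous_on S (\<lambda>x. f (fst x + h (snd x)))"
    by (rule continuous_on_compose2[OF assms continuous_on_add[OF continuous_on_fst[OF continuous_on_id] hs]])
      simp
  from continuous_on_mult[OF ws this] show ?thesis
    by (simp add: split_beta)
qed

lemma integrable_translate_integrand:
  fixes f :: "'a \<Rightarrow> real"
  assumes "continuous_on UNIV f"
  shows "(\<lambda>t. w t * f (p + h t)) integrable_on cbox a b"
proof (rule integrable_continuous)
  have "continuous_on (cbox a b) (\<lambda>t. (p, t))"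
    by (intro continuous_intros)
  from continuous_on_compose2[OF continuous_on_translate_integrand[OF assms, of UNIV] this]
  show "continuous_on (cbox a b) (\<lambda>t. w t * f (p + h t))" by simp
qed

lemma has_derivative_translate_average:
  assumes diff: "\<And>x. f differentiable (at x)"
    and cont: "\<And>b. b \<in> Basis \<Longrightarrow> continuous_on UNIV (dderiv f b)"
  shows "(translate_average h w f has_derivative (\<lambda>u. translate_average h w (dderiv f u) p)) (at p)"
proof -
  have bl: "bounded_linear (frechet_derivative f (at x))" for x
    by (rule has_derivative_bounded_linear[OF has_derivative_frechet[OF diff]])
  define D where "D x t = w t *\<^sub>R Blinfun (frechet_derivative f (at (x + h t)))" for x t
  have D: "blinfun_apply (D x t) u = w t * dderiv f u (x + h t)" for x t u
    by (simp add: D_def scaleR_blinfun.rep_eq bounded_linear_Blinfun_apply[OF bl])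
  have cf: "continuous_on UNIV f"
    using diff by (simp add: continuous_on_eq_continuous_within differentiable_imp_continuous_within)
  have cD: "continuous_on S (\<lambda>(x, t). D x t)" for S
    using continuous_on_translate_integrand[OF cont]
    by (intro continuous_on_blinfun_componentwise) (simp add: split_beta D)
  have "((\<lambda>x. integral (cbox 0 One) (\<lambda>t. w t * f (x + h t))) has_derivative
      blinfun_apply (integral (cbox 0 One) (D p))) (at p within UNIV)"
  proof (rule leibniz_rule)
    show "((\<lambda>x. w t * f (x + h t)) has_derivative blinfun_apply (D x t)) (at x within UNIV)" for x t
    proof -
      have "((\<lambda>x. x + h t) has_derivative (\<lambda>u. u)) (at x)"
        by (auto intro!: derivative_eq_intros)
      then show ?thesis
        unfolding D
        by (intro has_derivative_mult_right has_derivative_compose[OF _ has_derivative_frechet] diff)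
    qed
  qed (use integrable_translate_integrand[OF cf] cD in auto)
  moreover have "blinfun_apply (integral (cbox 0 One) (D p)) u =
      translate_average h w (dderiv f u) p" for u
  proof -
    have "D p integrable_on cbox 0 One"
    proof (rule integrable_continuous)
      have "continuous_on (cbox 0 One) (\<lambda>t. (p, t))"
        by (intro continuous_intros)
      from continuous_on_compose2[OF cD[of UNIV] this]
      show "continuous_on (cbox 0 One) (D p)" by simp
    qed
    then show ?thesis
      by (simp add: blinfun_apply_integral D translate_average_def)
  qed
  then have "blinfun_apply (integral (cbox 0 One) (D p)) = (\<lambda>u. translate_average h w (dderiv f u) p)"
    by (rule ext)
  ultimately show ?thesis
    by (simp only: translate_average_def[abs_def])
qed

lemma times_cont_diff_translate_average:
  "times_cont_diff k f \<Longrightarrow> times_cont_diff k (translate_average h w f)"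
proof (induction k arbitrary: f)
  case 0
  then show ?case
    using integral_continuous_on_param[OF continuous_on_translate_integrand[of f], of UNIV 0 One]
    by (simp add: translate_average_def[abs_def])
next
  case (Suc k)
  then have D: "(translate_average h w f has_derivative (\<lambda>u. translate_average h w (dderiv f u) p)) (at p)" for p
    by (intro has_derivative_translate_average)
      (simp_all add: times_cont_diff_imp_continuous[of k])
  have "dderiv (translate_average h w f) u = translate_average h w (dderiv f u)" for u
    by (rule ext, rule dderiv_eqI, rule D)
  moreover have "translate_average h w f differentiable (at p)" for p
    by (rule differentiableI, rule D)
  ultimately show ?case
    using Suc by simp
qed

lemma smooth_fun_translate_average: "smooth_fun f \<Longrightarrow> smooth_fun (translate_average h w f)"
  by (simp add: smooth_fun_def times_cont_diff_translate_average)

lemma dderiv_translate_average: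
  assumes "smooth_fun f"
  shows "dderiv (translate_average h w f) u = translate_average h w (dderiv f u)"
  by (rule ext, rule dderiv_eqI, rule has_derivative_translate_average)
    (simp_all add: assms smooth_fun_differentiable smooth_fun_continuous smooth_fun_dderiv)

end


section \<open>Comparing multiplicities by a separating family of maps\<close>

lemma sum_fun_apply: "(\<Sum>i\<in>A. f i) x = (\<Sum>i\<in>A. f i x :: real)"
  by (induction A rule: infinite_finite_induct) auto

lemma independent_finite_iff:
  assumes "finite S"
  shows "fun_space.independent S \<longleftrightarrow>
    (\<forall>c. (\<Sum>s\<in>S. (\<lambda>x. c s * s x)) = 0 \<longrightarrow> (\<forall>s\<in>S. c s = 0))"
  using assms by (auto simp: fun_space.dependent_finite)

context
  fixes E E' :: "('a \<Rightarrow> real) set" and I :: "'i set" and \<Phi> :: "'i \<Rightarrow> ('a \<Rightarrow> real) \<Rightarrow> 'a \<Rightarrow> real"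
    and C :: "('a \<Rightarrow> real) set"
  assumes C: "fun_space.subspace C" "E \<subseteq> C"
    and add: "\<And>i f g. i \<in> I \<Longrightarrow> f \<in> C \<Longrightarrow> g \<in> C \<Longrightarrow> \<Phi> i (f + g) = \<Phi> i f + \<Phi> i g"
    and scale: "\<And>i c f. i \<in> I \<Longrightarrow> f \<in> C \<Longrightarrow> \<Phi> i (\<lambda>x. c * f x) = (\<lambda>x. c * \<Phi> i f x)"
    and separating: "\<And>f. f \<in> C \<Longrightarrow> (\<And>i. i \<in> I \<Longrightarrow> \<Phi> i f = 0) \<Longrightarrow> f = 0"
begin

text \<open>
  Each further generator \<open>x\<close> enlarges the common kernel of the maps chosen so far by at most one
  dimension, spanned by some \<open>f\<close>; one more index that does not annihilate \<open>f\<close> kills it.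
\<close>

lemma finitely_many_separate_span:
  assumes "finite S" "S \<subseteq> C"
  shows "\<exists>M. finite M \<and> M \<subseteq> I \<and> (\<forall>f \<in> fun_space.span S. (\<forall>i\<in>M. \<Phi> i f = 0) \<longrightarrow> f = 0)"
  using assms
proof (induction S rule: finite_induct)
  case empty
  then show ?case
    by (intro exI[of _ "{}"]) auto
next
  case (insert x S)
  then have "S \<subseteq> C" by simp
  from insert.IH[OF this] obtain M where M: "finite M" "M \<subseteq> I"
    and inj': "\<forall>f \<in> fun_space.span S. (\<forall>i\<in>M. \<Phi> i f = 0) \<longrightarrow> f = 0"
    by (elim exE conjE)
  have inj: "f = 0" if "f \<in> fun_space.span S" "\<And>i. i \<in> M \<Longrightarrow> \<Phi> i f = 0" for f
    using inj' that by simp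
  have CI: "f \<in> C" if "f \<in> fun_space.span (insert x S)" for f
    using that insert.prems C(1) fun_space.span_minimal by blast
  show ?case
  proof (cases "\<exists>f \<in> fun_space.span (insert x S). f \<noteq> 0 \<and> (\<forall>i\<in>M. \<Phi> i f = 0)")
    case False
    then show ?thesis
      using M by blast
  next
    case True
    then obtain f where f: "f \<in> fun_space.span (insert x S)" "f \<noteq> 0" "\<And>i. i \<in> M \<Longrightarrow> \<Phi> i f = 0"
      by blast
    then obtain i where i: "i \<in> I" "\<Phi> i f \<noteq> 0"
      using separating CI by blast
    obtain k where k: "f - (\<lambda>y. k * x y) \<in> fun_space.span S"
      using f(1) by (auto simp: fun_space.span_insert)
    have "k \<noteq> 0"
    proof
      assume "k = 0"
      then have "f \<in> fun_space.span S"
        using k by (simp add: zero_fun_def[symmetric])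
      with inj f(2,3) show False by blast
    qed
    \<comment> \<open>The combination of \<open>g\<close> and \<open>f\<close> that cancels \<open>x\<close> lies in the span of \<open>S\<close> and in the common
      kernel, so \<open>g\<close> is a multiple of \<open>f\<close>.\<close>
    have "g = 0" if g: "g \<in> fun_space.span (insert x S)" "\<And>j. j \<in> insert i M \<Longrightarrow> \<Phi> j g = 0" for g
    proof -
      obtain l where l: "g - (\<lambda>y. l * x y) \<in> fun_space.span S"
        using g(1) by (auto simp: fun_space.span_insert)
      define r where "r = l / k"
      define d where "d = g + (\<lambda>y. - r * f y)"
      have "d = (g - (\<lambda>y. l * x y)) + (\<lambda>y. - r * (f - (\<lambda>y. k * x y)) y)"
        using \<open>k \<noteq> 0\<close> by (simp add: d_def r_def fun_eq_iff field_simps)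
      then have "d \<in> fun_space.span S"
        using k l by (metis fun_space.span_add fun_space.span_scale)
      have \<Phi>d: "\<Phi> j d = \<Phi> j g + (\<lambda>y. - r * \<Phi> j f y)" if "j \<in> I" for j
      proof -
        have "(\<lambda>y. - r * f y) \<in> C"
          by (rule fun_space.subspace_scale[OF C(1) CI[OF f(1)]])
        from add[OF that CI[OF g(1)] this] show ?thesis
          unfolding d_def scale[OF that CI[OF f(1)]] .
      qed
      have "\<Phi> j d = 0" if "j \<in> M" for j
        using \<Phi>d g(2) f(3) that M(2) by (auto simp: fun_eq_iff)
      then have "d = 0"
        using inj \<open>d \<in> fun_space.span S\<close> by blast
      then have "g = (\<lambda>y. r * f y)"
        by (simp add: d_def fun_eq_iff)
      then have "\<Phi> i g = (\<lambda>y. r * \<Phi> i f y)"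
        using scale i(1) CI f(1) by blast
      moreover have "\<Phi> i g = 0"
        using g(2) by blast
      ultimately have "r = 0"
        using i(2) by (auto simp: fun_eq_iff)
      then show ?thesis
        using \<open>g = _\<close> by (simp add: fun_eq_iff)
    qed
    then have "\<forall>g \<in> fun_space.span (insert x S). (\<forall>j\<in>insert i M. \<Phi> j g = 0) \<longrightarrow> g = 0"
      by blast
    moreover have "finite (insert i M)" "insert i M \<subseteq> I"
      using M i(1) by simp_all
    ultimately show ?thesis
      by blast
  qed
qed

text \<open>
  The maps \<open>\<Phi> i\<close> need not be injective one by one. Finitely many of them separate the span of a
  given finite set, and by the independence of their images their sum is injective on that span, so it
  carries independent sets to independent sets of the same size. In this way infinite multiplicities
  are covered as well.
\<close>

lemma multiplicity_of_le:
  assumes maps: "\<And>i f. i \<in> I \<Longrightarrow> f \<in> E \<Longrightarrow> \<Phi> i f \<in> E'"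
    and E': "0 \<in> E'" "\<And>f g. f \<in> E' \<Longrightarrow> g \<in> E' \<Longrightarrow> f + g \<in> E'"
    and indep: "\<And>M f. finite M \<Longrightarrow> M \<subseteq> I \<Longrightarrow> f \<in> C \<Longrightarrow> (\<Sum>i\<in>M. \<Phi> i f) = 0 \<Longrightarrow> \<forall>i\<in>M. \<Phi> i f = 0"
  shows "multiplicity_of E \<le> multiplicity_of E'"
  unfolding multiplicity_of_def
proof (rule SUP_least)
  fix S assume "S \<in> {S. finite S \<and> S \<subseteq> E \<and> fun_space.independent S}"
  then have S: "finite S" "S \<subseteq> E" "fun_space.independent S" by auto
  then have SC: "S \<subseteq> C" using C(2) by blast
  from finitely_many_separate_span[OF S(1) SC] obtain M where M: "finite M" "M \<subseteq> I"
    and inj': "\<forall>f \<in> fun_space.span S. (\<forall>i\<in>M. \<Phi> i f = 0) \<longrightarrow> f = 0"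
    by (elim exE conjE)
  have inj: "f = 0" if "f \<in> fun_space.span S" "\<And>i. i \<in> M \<Longrightarrow> \<Phi> i f = 0" for f
    using inj' that by simp
  define T where "T f = (\<Sum>i\<in>M. \<Phi> i f)" for f
  have CI: "f \<in> C" if "f \<in> fun_space.span S" for f
    using that SC C(1) fun_space.span_minimal by blast
  have ker: "f = 0" if "f \<in> fun_space.span S" "T f = 0" for f
    using indep[OF M CI[OF that(1)]] that inj by (auto simp: T_def)
  have T_add: "T (f + g) = T f + T g" if "f \<in> C" "g \<in> C" for f g
    using that M(2) add by (simp add: T_def subset_iff flip: sum.distrib)
  have T_scale: "T (\<lambda>x. c * f x) = (\<lambda>x. c * T f x)" if "f \<in> C" for f c
    using that M(2) scale
    by (simp add: T_def subset_iff sum_fun_apply sum_distrib_left fun_eq_iff cong: sum.cong)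
  have T_sum: "T (\<Sum>s\<in>A. (\<lambda>x. c s * s x)) = (\<Sum>s\<in>A. (\<lambda>x. c s * T s x))" if "A \<subseteq> S" "finite A" for A c
    using that(2,1)
  proof (induction A rule: finite_induct)
    case empty
    have "T (\<lambda>x. 0 * (0::'a \<Rightarrow> real) x) = (\<lambda>x. 0 * T 0 x)"
      by (rule T_scale[OF fun_space.subspace_0[OF C(1)]])
    then show ?case by (simp add: zero_fun_def)
  next
    case (insert a A)
    have a: "a \<in> C" "(\<lambda>x. c a * a x) \<in> C" and A: "(\<Sum>s\<in>A. (\<lambda>x. c s * s x)) \<in> C"
      using insert.prems SC C(1)
      by (auto intro!: fun_space.subspace_scale fun_space.subspace_sum)
    have "A \<subseteq> S" using insert.prems by simp
    then show ?case
      unfolding sum.insert[OF insert.hyps(1,2)] T_add[OF a(2) A] T_scale[OF a(1)]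
      by (simp only: insert.IH)
  qed
  have diff: "f = g" if "f \<in> S" "g \<in> S" "T f = T g" for f g
  proof -
    have "f + (\<lambda>x. -1 * g x) \<in> fun_space.span S"
      using that(1,2) by (intro fun_space.span_add fun_space.span_scale fun_space.span_base)
    moreover have "T (f + (\<lambda>x. -1 * g x)) = T f + (\<lambda>x. -1 * T g x)"
    proof -
      have fg: "f \<in> C" "g \<in> C"
        using that(1,2) SC by auto
      show ?thesis
        using T_add[OF fg(1) fun_space.subspace_scale[OF C(1) fg(2), of "-1"]] T_scale[OF fg(2), of "-1"]
        by simp
    qed
    then have "T (f + (\<lambda>x. -1 * g x)) = 0"
      using that(3) by (simp add: fun_eq_iff)
    ultimately have "f + (\<lambda>x. -1 * g x) = 0"
      by (rule ker)
    then show ?thesis by (simp add: fun_eq_iff)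
  qed
  then have injT: "inj_on T S" by (rule inj_onI)
  have "T ` S \<subseteq> E'"
  proof (rule image_subsetI)
    fix f assume "f \<in> S"
    have "(\<Sum>i\<in>A. \<Phi> i f) \<in> E'" if "A \<subseteq> M" "finite A" for A
      using that(2,1)
    proof (induction A rule: finite_induct)
      case empty
      show ?case unfolding sum.empty by (rule E'(1))
    next
      case (insert i A)
      have "\<Phi> i f \<in> E'"
        using maps \<open>f \<in> S\<close> S(2) M(2) insert.prems by blast
      moreover have "(\<Sum>i\<in>A. \<Phi> i f) \<in> E'"
        using insert by blast
      ultimately show ?case
        unfolding sum.insert[OF insert.hyps(1,2)] by (rule E'(2))
    qed
    then show "T f \<in> E'" using M(1) by (simp add: T_def)
  qed
  moreover have "fun_space.independent (T ` S)"
    unfolding independent_finite_iff[OF finite_imageI[OF S(1)]]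
  proof (intro allI impI)
    fix c assume "(\<Sum>t\<in>T ` S. (\<lambda>x. c t * t x)) = 0"
    then have "(\<Sum>s\<in>S. (\<lambda>x. c (T s) * T s x)) = 0"
      by (simp add: sum.reindex[OF injT])
    then have "T (\<Sum>s\<in>S. (\<lambda>x. c (T s) * s x)) = 0"
      using T_sum[of S "\<lambda>s. c (T s)"] S(1) by simp
    then have "(\<Sum>s\<in>S. (\<lambda>x. c (T s) * s x)) = 0"
      by (rule ker[rotated]) (intro fun_space.span_sum fun_space.span_scale fun_space.span_base)
    then show "\<forall>t\<in>T ` S. c t = 0"
      using S(3)[unfolded independent_finite_iff[OF S(1)], rule_format, of "\<lambda>s. c (T s)"] by blast
  qed
  ultimately have "enat (card (T ` S)) \<le> (SUP S \<in> {S. finite S \<and> S \<subseteq> E' \<and> fun_space.independent S}. enat (card S))"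
    using S(1) by (intro SUP_upper) auto
  then show "enat (card S) \<le> (SUP S \<in> {S. finite S \<and> S \<subseteq> E' \<and> fun_space.independent S}. enat (card S))"
    using injT by (simp add: card_image)
qed

end


section \<open>Integrals of periodic functions over the unit cube\<close>

definition unit_periodic :: "('t::euclidean_space \<Rightarrow> real) \<Rightarrow> bool" where
  "unit_periodic f \<longleftrightarrow> (\<forall>t. \<forall>e\<in>Basis. f (t + e) = f t)"

lemma unit_periodic_scale_int:
  assumes "unit_periodic f" "e \<in> Basis"
  shows "f (t + of_int k *\<^sub>R e) = f t"
proof -
  have nat: "f (t + real n *\<^sub>R e) = f t" for n t
  proof (induction n)
    case (Suc n)
    have "f (t + real (Suc n) *\<^sub>R e) = f ((t + real n *\<^sub>R e) + e)"
      by (simp add: algebra_simps)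
    also have "\<dots> = f (t + real n *\<^sub>R e)"
      using assms by (simp only: unit_periodic_def)
    finally show ?case
      using Suc by simp
  qed simp
  show ?thesis
  proof (cases "k \<ge> 0")
    case True
    then show ?thesis
      using nat[of t "nat k"] by simp
  next
    case False
    then show ?thesis
      using nat[of "t + of_int k *\<^sub>R e" "nat (- k)"] by simp
  qed
qed

lemma unit_periodic_int_vector:
  fixes f :: "'t::euclidean_space \<Rightarrow> real"
  assumes "unit_periodic f" and v: "\<And>b. b \<in> Basis \<Longrightarrow> v \<bullet> b \<in> \<int>"
  shows "f (t + v) = f t"
proof -
  have "f (t + (\<Sum>b\<in>A. (v \<bullet> b) *\<^sub>R b)) = f t" if "finite A" "A \<subseteq> Basis" for A
    using that
  proof (induction A rule: finite_induct)
    case (insert b A)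
    obtain k where k: "v \<bullet> b = of_int k"
      using v[of b] insert.prems by (auto elim: Ints_cases)
    have "f (t + (\<Sum>b\<in>insert b A. (v \<bullet> b) *\<^sub>R b)) =
        f ((t + (\<Sum>b\<in>A. (v \<bullet> b) *\<^sub>R b)) + of_int k *\<^sub>R b)"
      using insert.hyps by (simp add: k algebra_simps)
    also have "\<dots> = f (t + (\<Sum>b\<in>A. (v \<bullet> b) *\<^sub>R b))"
      using assms(1) insert.prems by (intro unit_periodic_scale_int) auto
    finally show ?case
      using insert by simp
  qed simp
  from this[of Basis] show ?thesis
    by (simp add: euclidean_representation)
qed

lemma integral_cbox_translate:
  fixes f :: "'t::euclidean_space \<Rightarrow> real"
  assumes "continuous_on UNIV f"
  shows "integral (cbox a b) (\<lambda>t. f (t + c)) = integral (cbox (a + c) (b + c)) f"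
proof -
  have "f integrable_on cbox (a + c) (b + c)"
    using assms by (intro integrable_continuous) (rule continuous_on_subset, auto)
  from has_integral_affinity[OF integrable_integral[OF this], of 1 c]
  have "((\<lambda>t. f (t + c)) has_integral integral (cbox (a + c) (b + c)) f)
      ((\<lambda>x. x - c) ` cbox (a + c) (b + c))"
    by simp
  moreover have "(\<lambda>x. x - c) ` cbox (a + c) (b + c) = cbox a b"
    using cbox_translation[of "- c" "a + c" "b + c"] by (simp add: algebra_simps)
  ultimately show ?thesis
    by (simp add: integral_unique)
qed

text \<open>
  Isolates one coordinate of a box, for cutting the box perpendicularly to \<open>e\<close>.
\<close>

lemma mem_cbox_split_Basis:
  fixes x :: "'t::euclidean_space"
  assumes "e \<in> Basis"
  shows "x \<in> cbox a b \<longleftrightarrow> a \<bullet> e \<le> x \<bullet> e \<and> x \<bullet> e \<le> b \<bullet> e \<and>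
    (\<forall>i\<in>Basis - {e}. a \<bullet> i \<le> x \<bullet> i \<and> x \<bullet> i \<le> b \<bullet> i)"
  using assms by (auto simp: mem_box)

text \<open>
  Cut the cube perpendicularly to \<open>e\<close> at height \<open>s\<close> and move the lower slab up by the period.
\<close>

lemma integral_unit_cube_shift_Basis:
  fixes f :: "'t::euclidean_space \<Rightarrow> real"
  assumes per: "unit_periodic f" and cont: "continuous_on UNIV f"
    and e: "e \<in> Basis" and s: "0 \<le> s" "s \<le> 1"
  shows "integral (cbox (a + s *\<^sub>R e) (a + One + s *\<^sub>R e)) f = integral (cbox a (a + One)) f"
proof -
  define b where "b = a + One"
  have be: "b \<bullet> e = a \<bullet> e + 1" and ee: "e \<bullet> e = 1" "\<And>i. i \<in> Basis - {e} \<Longrightarrow> e \<bullet> i = 0"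
    using e by (auto simp: b_def inner_add_left inner_Basis)
  note mem = mem_cbox_split_Basis[OF e]
  have int: "f integrable_on cbox u v" for u v
    using cont by (intro integrable_continuous) (rule continuous_on_subset, auto)
  have "integral (cbox a b) f = integral (cbox a b \<inter> {x. x \<bullet> e \<le> a \<bullet> e + s}) f +
      integral (cbox a b \<inter> {x. x \<bullet> e \<ge> a \<bullet> e + s}) f"
    by (rule integral_split[OF int e])
  also have "cbox a b \<inter> {x. x \<bullet> e \<le> a \<bullet> e + s} = cbox a (b + (s - 1) *\<^sub>R e)"
    using s by (auto simp: mem be ee inner_add_left inner_diff_left)
  also have "integral \<dots> f = integral (cbox a (b + (s - 1) *\<^sub>R e)) (\<lambda>t. f (t + e))"
    using per e by (simp add: unit_periodic_def)
  also have "\<dots> = integral (cbox (a + e) (b + s *\<^sub>R e)) f"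
    by (simp add: integral_cbox_translate[OF cont] scaleR_diff_left)
  also have "cbox a b \<inter> {x. x \<bullet> e \<ge> a \<bullet> e + s} = cbox (a + s *\<^sub>R e) b"
    using s by (auto simp: mem be ee inner_add_left inner_diff_left)
  finally have 1: "integral (cbox a b) f =
      integral (cbox (a + e) (b + s *\<^sub>R e)) f + integral (cbox (a + s *\<^sub>R e) b) f" .
  have "integral (cbox (a + s *\<^sub>R e) (b + s *\<^sub>R e)) f =
      integral (cbox (a + s *\<^sub>R e) (b + s *\<^sub>R e) \<inter> {x. x \<bullet> e \<le> b \<bullet> e}) f +
      integral (cbox (a + s *\<^sub>R e) (b + s *\<^sub>R e) \<inter> {x. x \<bullet> e \<ge> b \<bullet> e}) f"
    by (rule integral_split[OF int e])
  also have "cbox (a + s *\<^sub>R e) (b + s *\<^sub>R e) \<inter> {x. x \<bullet> e \<le> b \<bullet> e} = cbox (a + s *\<^sub>R e) b"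
    using s by (auto simp: mem be ee inner_add_left inner_diff_left)
  also have "cbox (a + s *\<^sub>R e) (b + s *\<^sub>R e) \<inter> {x. x \<bullet> e \<ge> b \<bullet> e} = cbox (a + e) (b + s *\<^sub>R e)"
    using s by (auto simp: mem be ee inner_add_left inner_diff_left)
  finally show ?thesis
    using 1 by (simp add: b_def)
qed

lemma integral_unit_cube_shift:
  fixes f :: "'t::euclidean_space \<Rightarrow> real"
  assumes per: "unit_periodic f" and cont: "continuous_on UNIV f"
  shows "integral (cbox 0 One) (\<lambda>t. f (t + v)) = integral (cbox 0 One) f"
proof -
  let ?r = "\<Sum>b\<in>Basis. frac (v \<bullet> b) *\<^sub>R b"
  have "integral (cbox (\<Sum>b\<in>A. frac (v \<bullet> b) *\<^sub>R b) ((\<Sum>b\<in>A. frac (v \<bullet> b) *\<^sub>R b) + One)) f =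
      integral (cbox 0 One) f" if "finite A" "A \<subseteq> Basis" for A
    using that
  proof (induction A rule: finite_induct)
    case (insert b A)
    let ?a = "\<Sum>b\<in>A. frac (v \<bullet> b) *\<^sub>R b"
    have "integral (cbox (?a + frac (v \<bullet> b) *\<^sub>R b) (?a + One + frac (v \<bullet> b) *\<^sub>R b)) f =
        integral (cbox ?a (?a + One)) f"
      using insert.prems frac_lt_1[of "v \<bullet> b"]
      by (intro integral_unit_cube_shift_Basis[OF per cont]) auto
    then show ?case
      using insert by (simp add: add_ac)
  qed simp
  from this[of Basis] have "integral (cbox ?r (?r + One)) f = integral (cbox 0 One) f"
    by simp
  then have "integral (cbox 0 One) (\<lambda>t. f (t + ?r)) = integral (cbox 0 One) f"
    using integral_cbox_translate[OF cont, of 0 One ?r] by (simp add: add.commute)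
  moreover have "f (t + v) = f (t + ?r)" for t
  proof -
    have "v - ?r = (\<Sum>b\<in>Basis. (v \<bullet> b - frac (v \<bullet> b)) *\<^sub>R b)"
      by (simp add: scaleR_diff_left sum_subtractf euclidean_representation)
    then have "f ((t + ?r) + (v - ?r)) = f (t + ?r)"
      by (intro unit_periodic_int_vector[OF per])
        (simp add: inner_sum_left inner_Basis frac_def if_distrib cong: if_cong)
    then show ?thesis by simp
  qed
  ultimately show ?thesis by simp
qed

lemma unit_cube_representative:
  fixes t :: "'t::euclidean_space"
  obtains r where "r \<in> cbox 0 One" "\<And>f :: 't \<Rightarrow> real. unit_periodic f \<Longrightarrow> f t = f r"
proof
  let ?r = "\<Sum>b\<in>Basis. frac (t \<bullet> b) *\<^sub>R b"
  show "?r \<in> cbox 0 One"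
    by (auto simp: mem_box inner_sum_left inner_Basis if_distrib frac_lt_1 less_imp_le cong: if_cong)
  show "f t = f ?r" if "unit_periodic f" for f :: "'t \<Rightarrow> real"
  proof -
    have "t - ?r = (\<Sum>b\<in>Basis. (t \<bullet> b - frac (t \<bullet> b)) *\<^sub>R b)"
      by (simp add: scaleR_diff_left sum_subtractf euclidean_representation)
    then have "f (?r + (t - ?r)) = f ?r"
      by (intro unit_periodic_int_vector[OF that])
        (simp add: inner_sum_left inner_Basis frac_def if_distrib cong: if_cong)
    then show ?thesis by simp
  qed
qed


section \<open>Completeness of the trigonometric system\<close>

definition int_vector :: "'t::euclidean_space \<Rightarrow> bool" where
  "int_vector m \<longleftrightarrow> (\<forall>b\<in>Basis. m \<bullet> b \<in> \<int>)"

text \<open>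
  Weights \<open>u\<close> orthogonal to all characters. Completeness says that only \<open>u = 0\<close> is both annihilated
  and periodic; keeping \<open>u\<close> general makes the class stable under multiplication by trigonometric
  polynomials, which is how orthogonality to the polynomials is obtained.
\<close>

definition fourier_annihilated :: "('t::euclidean_space \<Rightarrow> real) \<Rightarrow> bool" where
  "fourier_annihilated u \<longleftrightarrow> continuous_on UNIV u \<and>
     (\<forall>m. int_vector m \<longrightarrow>
        integral (cbox 0 One) (\<lambda>t. u t * cos (2 * pi * (m \<bullet> t))) = 0 \<and>
        integral (cbox 0 One) (\<lambda>t. u t * sin (2 * pi * (m \<bullet> t))) = 0)"

lemma integrable_continuous_UNIV:
  fixes u :: "'t::euclidean_space \<Rightarrow> real"
  assumes "continuous_on UNIV u" shows "u integrable_on cbox a b"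
  by (rule integrable_continuous) (rule continuous_on_subset[OF assms], simp)

lemma fourier_annihilated_add:
  assumes "fourier_annihilated u" "fourier_annihilated v"
  shows "fourier_annihilated (\<lambda>t. u t + v t)"
proof -
  have u: "continuous_on UNIV u" and v: "continuous_on UNIV v"
    using assms by (auto simp: fourier_annihilated_def)
  have "(\<lambda>t. u t * w t) integrable_on cbox 0 One" "(\<lambda>t. v t * w t) integrable_on cbox 0 One"
    if "continuous_on UNIV w" for w
    by (intro integrable_continuous_UNIV continuous_on_mult u v that)+
  moreover have "continuous_on UNIV (\<lambda>t. cos (2 * pi * (m \<bullet> t)))"
    "continuous_on UNIV (\<lambda>t. sin (2 * pi * (m \<bullet> t)))" for m :: 'a
    by (intro continuous_intros)+
  ultimately show ?thesis
    using assms u v by (simp add: fourier_annihilated_def distrib_right integral_add continuous_on_add)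
qed

lemma fourier_annihilated_cmult:
  "fourier_annihilated u \<Longrightarrow> fourier_annihilated (\<lambda>t. u t * c)"
  by (auto simp: fourier_annihilated_def mult.commute[of _ c] mult.assoc intro: continuous_on_mult_left)

lemma fourier_annihilated_0: "fourier_annihilated (\<lambda>t. 0)"
  by (simp add: fourier_annihilated_def)

lemma fourier_annihilated_sum:
  "(\<And>i. i \<in> I \<Longrightarrow> fourier_annihilated (u i)) \<Longrightarrow> fourier_annihilated (\<lambda>t. \<Sum>i\<in>I. u i t)"
  by (induction I rule: infinite_finite_induct)
    (simp_all add: fourier_annihilated_0 fourier_annihilated_add)

lemma int_vector_Basis:
  assumes "b \<in> Basis"
  shows "int_vector (b :: 't::euclidean_space)"
  using assms by (simp add: int_vector_def inner_Basis)

text \<open>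
  The product-to-sum formulas turn a product of two characters into characters again.
\<close>

lemma fourier_annihilated_mult_trig:
  fixes u :: "'t::euclidean_space \<Rightarrow> real"
  assumes u: "fourier_annihilated u" and k: "int_vector k"
  shows "fourier_annihilated (\<lambda>t. u t * cos (2 * pi * (k \<bullet> t)))"
    and "fourier_annihilated (\<lambda>t. u t * sin (2 * pi * (k \<bullet> t)))"
proof -
  have cu: "continuous_on UNIV u"
    using u by (simp add: fourier_annihilated_def)
  have int: "(\<lambda>t. u t * cos (2 * pi * (m \<bullet> t))) integrable_on cbox 0 One"
    "(\<lambda>t. u t * sin (2 * pi * (m \<bullet> t))) integrable_on cbox 0 One" for m
    by (intro integrable_continuous_UNIV continuous_on_mult cu continuous_intros)+
  have z: "integral (cbox 0 One) (\<lambda>t. u t * cos (2 * pi * (m \<bullet> t))) = 0"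
    "integral (cbox 0 One) (\<lambda>t. u t * sin (2 * pi * (m \<bullet> t))) = 0" if "int_vector m" for m
    using u that by (auto simp: fourier_annihilated_def)
  have km: "int_vector (m + k)" "int_vector (m - k)" if "int_vector m" for m
    using that k by (auto simp: int_vector_def inner_add_left inner_diff_left)
  have eq: "u t * cos (2 * pi * (k \<bullet> t)) * cos (2 * pi * (m \<bullet> t)) =
        (u t * cos (2 * pi * ((m + k) \<bullet> t)) + u t * cos (2 * pi * ((m - k) \<bullet> t))) * (1/2)"
    "u t * cos (2 * pi * (k \<bullet> t)) * sin (2 * pi * (m \<bullet> t)) =
        (u t * sin (2 * pi * ((m + k) \<bullet> t)) + u t * sin (2 * pi * ((m - k) \<bullet> t))) * (1/2)"
    "u t * sin (2 * pi * (k \<bullet> t)) * cos (2 * pi * (m \<bullet> t)) =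
        (u t * sin (2 * pi * ((m + k) \<bullet> t)) - u t * sin (2 * pi * ((m - k) \<bullet> t))) * (1/2)"
    "u t * sin (2 * pi * (k \<bullet> t)) * sin (2 * pi * (m \<bullet> t)) =
        (u t * cos (2 * pi * ((m - k) \<bullet> t)) - u t * cos (2 * pi * ((m + k) \<bullet> t))) * (1/2)" for t m
    by (simp_all add: inner_add_left inner_diff_left distrib_left right_diff_distrib cos_add sin_add
        cos_diff sin_diff)
  show "fourier_annihilated (\<lambda>t. u t * cos (2 * pi * (k \<bullet> t)))"
    unfolding fourier_annihilated_def eq integral_mult_left
    using int z km
    by (auto simp: integral_add intro!: continuous_on_mult cu continuous_intros)
  show "fourier_annihilated (\<lambda>t. u t * sin (2 * pi * (k \<bullet> t)))"
    unfolding fourier_annihilated_def eq integral_mult_left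
    using int z km
    by (auto simp: integral_diff intro!: continuous_on_mult cu continuous_intros)
qed

text \<open>
  The standard embedding of the torus as a compact subset of a Euclidean space; a function of
  period one in each coordinate descends to its image.
\<close>

definition torus_embedding :: "'t::euclidean_space \<Rightarrow> 't \<times> 't" where
  "torus_embedding t =
     (\<Sum>b\<in>Basis. cos (2 * pi * (b \<bullet> t)) *\<^sub>R b, \<Sum>b\<in>Basis. sin (2 * pi * (b \<bullet> t)) *\<^sub>R b)"

lemma continuous_on_torus_embedding: "continuous_on S torus_embedding"
  unfolding torus_embedding_def by (intro continuous_intros)

lemma torus_embedding_eq_imp:
  assumes f: "unit_periodic f" and eq: "torus_embedding s = torus_embedding t"
  shows "f s = f t"
proof -
  have comp: "fst (torus_embedding x) \<bullet> b = cos (2 * pi * (b \<bullet> x))"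
    "snd (torus_embedding x) \<bullet> b = sin (2 * pi * (b \<bullet> x))" if "b \<in> Basis" for x b :: 'a
    using that by (simp_all add: torus_embedding_def inner_sum_left inner_Basis if_distrib cong: if_cong)
  have "(s - t) \<bullet> b \<in> \<int>" if b: "b \<in> Basis" for b
  proof -
    have "\<exists>n::int. 2 * pi * (b \<bullet> s) = 2 * pi * (b \<bullet> t) + 2 * pi * n"
      using comp[OF b, of s] comp[OF b, of t] eq
      by (intro sin_cos_eq_iff[THEN iffD1]) simp
    then obtain n :: int where "2 * pi * (b \<bullet> s) = 2 * pi * (b \<bullet> t + n)"
      by (auto simp: distrib_left)
    then have "b \<bullet> s = b \<bullet> t + n"
      by simp
    then show ?thesis
      by (simp add: inner_diff_right inner_commute[of _ b])
  qed
  then have "f (t + (s - t)) = f t"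
    by (rule unit_periodic_int_vector[OF f])
  then show ?thesis by simp
qed

text \<open>
  Polynomials in the coordinates of the embedded torus are trigonometric polynomials. The
  induction on the polynomial works with all annihilated weights at once, so that products need
  no expansion.
\<close>

lemma fourier_annihilated_mult_polynomial:
  assumes "real_polynomial_function p"
  shows "fourier_annihilated u \<Longrightarrow> fourier_annihilated (\<lambda>t. u t * p (torus_embedding t))"
  using assms
proof (induction p arbitrary: u rule: real_polynomial_function.induct)
  case (linear p)
  then interpret bounded_linear p by simp
  have "p (torus_embedding t) = (\<Sum>b\<in>Basis. cos (2 * pi * (b \<bullet> t)) * p (b, 0)) +
      (\<Sum>b\<in>Basis. sin (2 * pi * (b \<bullet> t)) * p (0, b))" for t
  proof -
    have "torus_embedding t = (\<Sum>b\<in>Basis. cos (2 * pi * (b \<bullet> t)) *\<^sub>R (b, 0)) +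
        (\<Sum>b\<in>Basis. sin (2 * pi * (b \<bullet> t)) *\<^sub>R (0, b))"
      by (simp add: torus_embedding_def prod_eq_iff fst_sum snd_sum)
    then show ?thesis
      by (simp only: add sum scaleR real_scaleR_def)
  qed
  then have eq: "u t * p (torus_embedding t) =
      (\<Sum>b\<in>Basis. u t * cos (2 * pi * (b \<bullet> t)) * p (b, 0)) +
      (\<Sum>b\<in>Basis. u t * sin (2 * pi * (b \<bullet> t)) * p (0, b))" for t
    by (simp add: distrib_left sum_distrib_left mult.assoc)
  show ?case
    unfolding eq
    by (intro fourier_annihilated_add fourier_annihilated_sum fourier_annihilated_cmult
        fourier_annihilated_mult_trig linear.prems int_vector_Basis)
next
  case (const c)
  then show ?case by (rule fourier_annihilated_cmult)
next
  case (add p q)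
  then show ?case by (simp add: distrib_left fourier_annihilated_add)
next
  case (mult p q)
  then show ?case by (simp flip: mult.assoc)
qed

text \<open>
  Stone--Weierstrass on the embedded torus. The function induced by \<open>f\<close> on the image is continuous
  because the embedding restricted to the closed cube is a map from a compact space, hence
  closed.
\<close>

lemma trigonometric_approximation:
  fixes f :: "'t::euclidean_space \<Rightarrow> real"
  assumes per: "unit_periodic f" and cont: "continuous_on UNIV f" and "0 < e"
  obtains p where "real_polynomial_function p" "\<And>t. \<bar>f t - p (torus_embedding t)\<bar> < e"
proof -
  let ?K = "torus_embedding ` (cbox 0 One :: 't set)"
  have K: "torus_embedding t \<in> ?K" for t
  proof -
    obtain r where r: "r \<in> cbox 0 One" "\<And>f :: 't \<Rightarrow> real. unit_periodic f \<Longrightarrow> f t = f r"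
      using unit_cube_representative by blast
    have "cos (2 * pi * (b \<bullet> t)) = cos (2 * pi * (b \<bullet> r))" "sin (2 * pi * (b \<bullet> t)) = sin (2 * pi * (b \<bullet> r))"
      if "b \<in> Basis" for b
      using that
      by (auto intro!: r(2) simp: unit_periodic_def inner_add_right inner_Basis distrib_left)
    then have "torus_embedding t = torus_embedding r"
      by (simp add: torus_embedding_def)
    then show ?thesis using r(1) by blast
  qed
  define \<psi> where "\<psi> k = f (SOME t. torus_embedding t = k)" for k
  have \<psi>: "\<psi> (torus_embedding t) = f t" for t
    unfolding \<psi>_def by (rule torus_embedding_eq_imp[OF per]) (rule someI[of _ t], rule refl)
  have compact: "compact ?K"
    by (intro compact_continuous_image continuous_on_torus_embedding compact_cbox)
  have "continuous_on ?K \<psi>"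
  proof (subst continuous_on_closed_vimage[OF compact_imp_closed[OF compact]], intro allI impI)
    fix B :: "real set" assume "closed B"
    have "\<psi> -` B \<inter> ?K = torus_embedding ` (cbox 0 One \<inter> f -` B)"
      using \<psi> by auto
    moreover have "compact (cbox 0 One \<inter> f -` B)"
      using closed_vimage[OF \<open>closed B\<close> cont] by (intro compact_Int_closed compact_cbox)
    ultimately show "closed (\<psi> -` B \<inter> ?K)"
      by (auto intro!: compact_imp_closed compact_continuous_image continuous_on_torus_embedding)
  qed
  then obtain p where "polynomial_function p" "\<And>x. x \<in> ?K \<Longrightarrow> norm (\<psi> x - p x) < e"
    using Stone_Weierstrass_polynomial_function[OF compact _ \<open>0 < e\<close>, of \<psi>] by blast
  note p = this
  show ?thesis
  proof (rule that)
    show "real_polynomial_function p"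
      using p(1) by (simp add: real_polynomial_function_eq)
    show "\<bar>f t - p (torus_embedding t)\<bar> < e" for t
      using p(2)[OF K[of t]] by (simp add: \<psi>)
  qed
qed

text \<open>
  For a trigonometric polynomial \<open>g\<close> close to \<open>f\<close>, orthogonality of \<open>f\<close> and \<open>g\<close> gives that the
  integral of \<open>f\<^sup>2\<close> is at most that of \<open>(f - g)\<^sup>2\<close>, which is arbitrarily small.
\<close>

lemma fourier_coefficients_zero_imp_zero:
  fixes f :: "'t::euclidean_space \<Rightarrow> real"
  assumes per: "unit_periodic f" and ann: "fourier_annihilated f"
  shows "f t = 0"
proof -
  have cont: "continuous_on UNIV f"
    using ann by (simp add: fourier_annihilated_def)
  let ?I = "integral (cbox 0 One)"
  define I where "I = ?I (\<lambda>t. f t * f t)"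
  have int: "g integrable_on cbox 0 One" if "continuous_on UNIV g" for g :: "'t \<Rightarrow> real"
    by (rule integrable_continuous_UNIV[OF that])
  have "I \<le> e" if "0 < e" for e
  proof -
    \<comment> \<open>An error below both \<open>e\<close> and \<open>1\<close> has a square below \<open>e\<close>.\<close>
    have "0 < min e 1" using that by simp
    then obtain p where p: "real_polynomial_function p"
      and close: "\<And>t. \<bar>f t - p (torus_embedding t)\<bar> < min e 1"
      using trigonometric_approximation[OF per cont] by blast
    let ?g = "\<lambda>t. p (torus_embedding t)"
    have cg: "continuous_on UNIV ?g"
      using continuous_on_compose2[OF continuous_on_polymonial_function _ subset_UNIV]
        p continuous_on_torus_embedding by (auto simp: real_polynomial_function_eq)
    have "fourier_annihilated (\<lambda>t. f t * ?g t)"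
      by (rule fourier_annihilated_mult_polynomial[OF p ann])
    moreover have "int_vector (0 :: 't)"
      by (simp add: int_vector_def)
    ultimately have fg: "?I (\<lambda>t. f t * ?g t) = 0"
      by (auto simp: fourier_annihilated_def dest!: spec[of _ "0 :: 't"])
    have "I + ?I (\<lambda>t. ?g t * ?g t) = ?I (\<lambda>t. (f t - ?g t) * (f t - ?g t))"
    proof -
      have "?I (\<lambda>t. (f t - ?g t) * (f t - ?g t)) =
          ?I (\<lambda>t. (f t * f t + ?g t * ?g t) - (f t * ?g t) * 2)"
        by (simp add: algebra_simps)
      also have "\<dots> = ?I (\<lambda>t. f t * f t + ?g t * ?g t) - ?I (\<lambda>t. (f t * ?g t) * 2)"
        by (intro integral_diff int continuous_intros cont cg)
      also have "?I (\<lambda>t. f t * f t + ?g t * ?g t) = I + ?I (\<lambda>t. ?g t * ?g t)"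
        unfolding I_def by (intro integral_add int continuous_intros cont cg)
      also have "?I (\<lambda>t. (f t * ?g t) * 2) = 0"
        using fg by (simp only: integral_mult_left)
      finally show ?thesis by simp
    qed
    moreover have "0 \<le> ?I (\<lambda>t. ?g t * ?g t)"
      by (intro integral_nonneg int continuous_intros cg) simp
    moreover have "?I (\<lambda>t. (f t - ?g t) * (f t - ?g t)) \<le> ?I (\<lambda>t::'t. e)"
    proof (intro integral_le int continuous_intros cont cg)
      fix t
      have "\<bar>f t - ?g t\<bar> * \<bar>f t - ?g t\<bar> \<le> e * 1"
        using close[of t] that by (intro mult_mono) auto
      then show "(f t - ?g t) * (f t - ?g t) \<le> e"
        by (simp flip: abs_mult)
    qed
    ultimately show "I \<le> e" by simp
  qed
  then have "I \<le> 0"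
    by (rule field_le_epsilon) simp
  moreover have "0 \<le> I"
    unfolding I_def by (intro integral_nonneg int continuous_intros cont) simp
  ultimately have "((\<lambda>t. f t * f t) has_integral 0) (cbox 0 One)"
    using integrable_integral[OF int[OF continuous_on_mult[OF cont cont]]] by (simp add: I_def)
  moreover obtain r where r: "r \<in> cbox 0 One" "\<And>f :: 't \<Rightarrow> real. unit_periodic f \<Longrightarrow> f t = f r"
    using unit_cube_representative by blast
  moreover have "continuous_on (cbox 0 One) (\<lambda>t. f t * f t)"
    by (intro continuous_on_mult continuous_on_subset[OF cont] subset_UNIV)
  moreover have "box (0 :: 't) One \<noteq> {}"
    by (simp add: box_ne_empty)
  ultimately have "f r * f r = 0"
    using has_integral_0_cbox_imp_0[where f = "\<lambda>t. f t * f t" and x = r and a = 0 and b = One]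
    by simp
  then show ?thesis
    using r(2)[OF per] by simp
qed


section \<open>The Laplacian and the boundary normal of the left-invariant metric\<close>

lemma fst_lie_bracket [simp]: "fst (lie_bracket J p q) = 0"
  by (simp add: lie_bracket_def)

lemma lie_bracket_zero_right [simp]: "fst q = 0 \<Longrightarrow> lie_bracket J p q = 0"
  by (simp add: lie_bracket_def zero_prod_def)

lemma lie_bracket_cong:
  "fst p = fst p' \<Longrightarrow> fst q = fst q' \<Longrightarrow> lie_bracket J p q = lie_bracket J p' q'"
  by (simp add: lie_bracket_def)

lemma linear_lie_bracket_right: "linear (lie_bracket J p)"
  by (rule linearI)
    (simp_all add: lie_bracket_def inner_add_right scaleR_add_left sum.distrib scaleR_sum_right)

text \<open>
  The left-invariant vector field with value \<open>b\<close> at the identity.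
\<close>

definition frame_field ::
  "('z::euclidean_space \<Rightarrow> 'v::euclidean_space \<Rightarrow> 'v) \<Rightarrow> 'v \<times> 'z \<Rightarrow> 'v \<times> 'z \<Rightarrow> 'v \<times> 'z" where
  "frame_field J b p = b + (1/2) *\<^sub>R lie_bracket J p b"

lemma fst_frame_field [simp]: "fst (frame_field J b p) = fst b"
  by (simp add: frame_field_def)

lemma frame_field_cong: "fst p = fst q \<Longrightarrow> frame_field J b p = frame_field J b q"
  by (simp add: frame_field_def lie_bracket_cong[of p q b b])

lemma linear_frame_field: "linear (\<lambda>b. frame_field J b p)"
  using linear_compose_add[OF linear_id linear_compose_scale_right[OF linear_lie_bracket_right]]
  by (simp add: frame_field_def)

lemma sum_Basis_linear_functional:
  fixes l :: "'a::euclidean_space \<Rightarrow> real"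
  assumes "linear l"
  shows "(\<Sum>c\<in>Basis. (x \<bullet> c) * l c) = l x"
proof -
  have "l x = l (\<Sum>c\<in>Basis. (x \<bullet> c) *\<^sub>R c)"
    by (simp add: euclidean_representation)
  then show ?thesis
    by (simp only: linear_sum[OF assms] linear_cmul[OF assms] real_scaleR_def)
qed

abbreviation dderiv2 :: "('a::real_normed_vector \<Rightarrow> real) \<Rightarrow> 'a \<Rightarrow> 'a \<Rightarrow> 'a \<Rightarrow> real" where
  "dderiv2 f u v \<equiv> dderiv (dderiv f u) v"

lemma linear_dderiv:
  assumes "smooth_fun f" shows "linear (\<lambda>u. dderiv f u p)"
  by (rule linear_frechet_derivative[OF smooth_fun_differentiable[OF assms]])

lemma linear_dderiv2_right:
  assumes "smooth_fun f" shows "linear (\<lambda>v. dderiv2 f u v p)"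
  by (rule linear_dderiv[OF smooth_fun_dderiv[OF assms]])

lemma linear_dderiv2_left:
  assumes f: "smooth_fun f" shows "linear (\<lambda>u. dderiv2 f u v p)"
proof (rule linearI)
  note diff = smooth_fun_differentiable[OF smooth_fun_dderiv[OF f]]
  note lin = linear_dderiv[OF f]
  show "dderiv2 f (u + u') v p = dderiv2 f u v p + dderiv2 f u' v p" for u u'
    using dderiv_add[OF diff diff, of u u' v] by (simp add: linear_add[OF lin] fun_eq_iff)
  show "dderiv2 f (c *\<^sub>R u) v p = c *\<^sub>R dderiv2 f u v p" for c u
    using dderiv_cmult[OF diff, of c u v] by (simp add: linear_cmul[OF lin] fun_eq_iff)
qed

context
  fixes J :: "'z::euclidean_space \<Rightarrow> 'v::euclidean_space \<Rightarrow> 'v"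
  assumes nil: "metric_two_step_nilpotent J"
begin

lemma linear_J: "linear (J Z)"
  using nil by (simp add: metric_two_step_nilpotent_def)

lemma skew_J: "J Z X \<bullet> Y = - (X \<bullet> J Z Y)"
  using nil by (simp add: metric_two_step_nilpotent_def)

lemma linear_lie_bracket_left: "linear (\<lambda>p. lie_bracket J p q)"
  by (rule linearI)
    (simp_all add: lie_bracket_def linear_add[OF linear_J] linear_cmul[OF linear_J] inner_add_left
      scaleR_add_left sum.distrib scaleR_sum_right)

lemma lie_bracket_zero_left: "fst p = 0 \<Longrightarrow> lie_bracket J p q = 0"
  by (simp add: lie_bracket_def linear_0[OF linear_J] zero_prod_def)

lemma lie_bracket_self: "fst p = fst q \<Longrightarrow> lie_bracket J p q = 0"
proof -
  have "J Z X \<bullet> X = 0" for Z X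
    using skew_J[of Z X X] by (simp add: inner_commute)
  then show "fst p = fst q \<Longrightarrow> lie_bracket J p q = 0"
    by (simp add: lie_bracket_def zero_prod_def)
qed

lemma inner_snd_lie_bracket: "snd (lie_bracket J p q) \<bullet> Z = J Z (fst p) \<bullet> fst q"
  using nil by (intro lie_bracket_inner) (simp add: metric_two_step_nilpotent_def)

lemma left_inv_metric_frame_field:
  "left_inv_metric J p (frame_field J u p) w = u \<bullet> (w - (1/2) *\<^sub>R lie_bracket J p w)"
proof -
  have "lie_bracket J p (frame_field J u p) = lie_bracket J p u"
    by (rule lie_bracket_cong) simp_all
  then show ?thesis
    by (simp add: left_inv_metric_eq[OF nil] frame_field_def)
qed

text \<open>
  The differential of left translation is unipotent, and changing the sign of the centre
  conjugates it into its inverse.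
\<close>

lemma gram_det_left_inv_metric: "gram_det (left_inv_metric J) p = 1"
proof (rule gram_det_pullback_eq_1)
  show "left_inv_metric J p u w =
      (u - (1/2) *\<^sub>R lie_bracket J p u) \<bullet> (w - (1/2) *\<^sub>R lie_bracket J p w)" for u w
    by (rule left_inv_metric_eq[OF nil])
  show "linear (\<lambda>u. u - (1/2) *\<^sub>R lie_bracket J p u)"
    by (intro linear_compose_sub linear_compose_scale_right linear_lie_bracket_right linear_ident)
  show "linear (\<lambda>u. (fst u, - snd u))" for u :: "'v \<times> 'z"
    by (rule linearI) simp_all
  have "lie_bracket J p (fst u, y) = lie_bracket J p u" for u y
    by (rule lie_bracket_cong) simp_all
  then show "(\<lambda>u. u - (1/2) *\<^sub>R lie_bracket J p u) \<circ> ((\<lambda>u. (fst u, - snd u)) \<circ>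
      ((\<lambda>u. u - (1/2) *\<^sub>R lie_bracket J p u) \<circ> (\<lambda>u. (fst u, - snd u)))) = id"
    by (simp add: fun_eq_iff prod_eq_iff)
  show "(\<lambda>u. (fst u, - snd u)) \<circ> (\<lambda>u. (fst u, - snd u)) = (id :: 'v \<times> 'z \<Rightarrow> 'v \<times> 'z)"
    by (simp add: fun_eq_iff)
qed

text \<open>
  The frame is orthonormal, so the gradient has the derivatives along the frame as its
  coefficients.
\<close>

lemma grad_left_inv_metric:
  assumes "smooth_fun F"
  shows "grad (left_inv_metric J) F p = (\<Sum>b\<in>Basis. dderiv F (frame_field J b p) p *\<^sub>R frame_field J b p)"
    (is "_ = ?W")
  unfolding grad_def
proof (rule the_equality)
  let ?A = "\<lambda>u. u - (1/2) *\<^sub>R lie_bracket J p u"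
  have frame_A: "frame_field J (?A u) p = u" for u
  proof -
    have "lie_bracket J p (?A u) = lie_bracket J p u"
      by (rule lie_bracket_cong) simp_all
    then show ?thesis
      by (simp add: frame_field_def)
  qed
  have lin: "linear (\<lambda>b. dderiv F (frame_field J b p) p)"
    using linear_compose[OF linear_frame_field linear_dderiv[OF assms]] by (simp add: o_def)
  have W: "?W = frame_field J (\<Sum>b\<in>Basis. dderiv F (frame_field J b p) p *\<^sub>R b) p"
    by (simp add: linear_sum[OF linear_frame_field] linear_cmul[OF linear_frame_field])
  show W_metric: "\<forall>u. left_inv_metric J p ?W u = dderiv F u p"
  proof
    fix u
    have "left_inv_metric J p ?W u = (\<Sum>b\<in>Basis. (?A u \<bullet> b) * dderiv F (frame_field J b p) p)"
      unfolding W left_inv_metric_frame_field by (simp add: inner_sum_left mult.commute inner_commute[of "?A u"])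
    also have "\<dots> = dderiv F (frame_field J (?A u) p) p"
      by (rule sum_Basis_linear_functional[OF lin])
    finally show "left_inv_metric J p ?W u = dderiv F u p"
      by (simp only: frame_A)
  qed
  fix w assume w: "\<forall>u. left_inv_metric J p w u = dderiv F u p"
  have lA: "linear ?A"
    by (intro linear_compose_sub linear_compose_scale_right linear_lie_bracket_right linear_ident)
  have "?A w \<bullet> ?A u = ?A ?W \<bullet> ?A u" for u
    using w W_metric by (simp only: left_inv_metric_eq[OF nil])
  then have "?A w \<bullet> ?A (w - ?W) = ?A ?W \<bullet> ?A (w - ?W)" .
  then have "?A (w - ?W) \<bullet> ?A (w - ?W) = 0"
    by (simp only: linear_diff[OF lA] inner_diff_left)
  then have "?A (w - ?W) = 0"
    by (simp only: inner_eq_zero_iff)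
  then have "w - ?W = 0"
    using frame_A[of "w - ?W"] linear_0[OF linear_frame_field] by metis
  then show "w = ?W" by simp
qed

lemma linear_half_lie_bracket: "linear (\<lambda>u. (1/2) *\<^sub>R lie_bracket J u b)"
  by (intro linear_compose_scale_right linear_lie_bracket_left)

lemma has_derivative_frame_field_inner:
  "((\<lambda>q. frame_field J b q \<bullet> c) has_derivative (\<lambda>u. (1/2) *\<^sub>R lie_bracket J u b \<bullet> c)) (at p)"
proof -
  have "((\<lambda>u. (1/2) *\<^sub>R lie_bracket J u b) has_derivative (\<lambda>u. (1/2) *\<^sub>R lie_bracket J u b)) (at p)"
    using linear_half_lie_bracket
    by (simp add: linear_conv_bounded_linear bounded_linear_imp_has_derivative)
  from has_derivative_add[OF has_derivative_const[of b] this]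
  have "((\<lambda>q. frame_field J b q) has_derivative (\<lambda>u. (1/2) *\<^sub>R lie_bracket J u b)) (at p)"
    by (simp add: frame_field_def)
  then show ?thesis
    by (rule has_derivative_inner_left)
qed

lemma has_derivative_dderiv_frame_field:
  assumes F: "smooth_fun F"
  shows "((\<lambda>q. dderiv F (frame_field J b q) q) has_derivative
    (\<lambda>u. dderiv F ((1/2) *\<^sub>R lie_bracket J u b) p + dderiv2 F (frame_field J b p) u p)) (at p)"
proof -
  let ?L = "\<lambda>u. (1/2) *\<^sub>R lie_bracket J u b"
  note E = has_derivative_frame_field_inner
  have D: "(dderiv F d has_derivative (\<lambda>u. dderiv2 F d u p)) (at p)" for d
    by (rule has_derivative_frechet[OF smooth_fun_differentiable[OF smooth_fun_dderiv[OF F]]])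
  have "((\<lambda>q. \<Sum>d\<in>Basis. (frame_field J b q \<bullet> d) * dderiv F d q) has_derivative
      (\<lambda>u. \<Sum>d\<in>Basis. (frame_field J b p \<bullet> d) * dderiv2 F d u p + (?L u \<bullet> d) * dderiv F d p)) (at p)"
    by (intro has_derivative_sum has_derivative_mult E D)
  moreover have "(\<lambda>q. \<Sum>d\<in>Basis. (frame_field J b q \<bullet> d) * dderiv F d q) =
      (\<lambda>q. dderiv F (frame_field J b q) q)"
    by (rule ext, rule sum_Basis_linear_functional[OF linear_dderiv[OF F]])
  moreover have "(\<lambda>u. \<Sum>d\<in>Basis. (frame_field J b p \<bullet> d) * dderiv2 F d u p + (?L u \<bullet> d) * dderiv F d p) =
      (\<lambda>u. dderiv F (?L u) p + dderiv2 F (frame_field J b p) u p)"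
    by (rule ext) (simp only: sum.distrib sum_Basis_linear_functional[OF linear_dderiv[OF F]]
      sum_Basis_linear_functional[OF linear_dderiv2_left[OF F]] add.commute)
  ultimately show ?thesis by simp
qed

text \<open>
  The volume density is constant, the frame fields are divergence free, and each of them is constant
  along its own integral curves since \<open>[b, b] = 0\<close>. Hence the Laplacian has no first-order terms.
\<close>

lemma laplacian_left_inv_metric:
  assumes F: "smooth_fun F"
  shows "laplacian (left_inv_metric J) F p =
    (\<Sum>b\<in>Basis. dderiv2 F (frame_field J b p) (frame_field J b p) p)"
proof -
  let ?E = "\<lambda>b. frame_field J b p" and ?L = "\<lambda>u b. (1/2) *\<^sub>R lie_bracket J u b"
  note E = has_derivative_frame_field_inner
  have trace: "?L c b \<bullet> c = 0" if "c \<in> Basis" for b c :: "'v \<times> 'z"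
    using that lie_bracket_zero_left[of c b] by (auto simp: Basis_prod_def inner_prod_def)
  have comp: "dderiv (\<lambda>q. sqrt (gram_det (left_inv_metric J) q) * (grad (left_inv_metric J) F q \<bullet> c)) c p =
      (\<Sum>b\<in>Basis. (?E b \<bullet> c) * dderiv F (?L c b) p + (?E b \<bullet> c) * dderiv2 F (?E b) c p)"
    if c: "c \<in> Basis" for c
  proof -
    have "((\<lambda>q. \<Sum>b\<in>Basis. dderiv F (frame_field J b q) q * (frame_field J b q \<bullet> c)) has_derivative
      (\<lambda>u. \<Sum>b\<in>Basis. dderiv F (?E b) p * (?L u b \<bullet> c) +
        (dderiv F (?L u b) p + dderiv2 F (?E b) u p) * (?E b \<bullet> c))) (at p)"
      by (intro has_derivative_sum has_derivative_mult has_derivative_dderiv_frame_field[OF F] E)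
    from dderiv_eqI[OF this, of c] show ?thesis
      unfolding trace[OF c]
      by (simp add: gram_det_left_inv_metric grad_left_inv_metric[OF F] inner_sum_left algebra_simps)
  qed
  have "laplacian (left_inv_metric J) F p =
      (\<Sum>c\<in>Basis. \<Sum>b\<in>Basis. (?E b \<bullet> c) * dderiv F (?L c b) p + (?E b \<bullet> c) * dderiv2 F (?E b) c p)"
    by (simp only: laplacian_def divergence_def comp cong: sum.cong)
      (simp add: gram_det_left_inv_metric)
  also have "\<dots> = (\<Sum>b\<in>Basis. \<Sum>c\<in>Basis. (?E b \<bullet> c) * dderiv F (?L c b) p + (?E b \<bullet> c) * dderiv2 F (?E b) c p)"
    by (rule sum.swap)
  also have "\<dots> = (\<Sum>b\<in>Basis. dderiv F (?L (?E b) b) p + dderiv2 F (?E b) (?E b) p)"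
  proof (rule sum.cong[OF refl])
    fix b :: "'v \<times> 'z"
    from linear_compose[OF linear_half_lie_bracket linear_dderiv[OF F, of p]] have lin: "linear (\<lambda>c. dderiv F (?L c b) p)"
      by (simp add: o_def)
    show "(\<Sum>c\<in>Basis. (?E b \<bullet> c) * dderiv F (?L c b) p + (?E b \<bullet> c) * dderiv2 F (?E b) c p) =
        dderiv F (?L (?E b) b) p + dderiv2 F (?E b) (?E b) p"
      by (simp only: sum.distrib sum_Basis_linear_functional[OF lin]
          sum_Basis_linear_functional[OF linear_dderiv2_right[OF F]])
  qed
  also have "\<dots> = (\<Sum>b\<in>Basis. dderiv2 F (?E b) (?E b) p)"
    by (simp add: lie_bracket_self linear_0[OF linear_dderiv[OF F]])
  finally show ?thesis .
qed

lemma laplacian_add: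
  assumes F: "smooth_fun F" and G: "smooth_fun G"
  shows "laplacian (left_inv_metric J) (\<lambda>p. F p + G p) q =
    laplacian (left_inv_metric J) F q + laplacian (left_inv_metric J) G q"
proof -
  have "dderiv2 (\<lambda>p. F p + G p) u v q = dderiv2 F u v q + dderiv2 G u v q" for u v
    unfolding dderiv_add[OF smooth_fun_differentiable[OF F] smooth_fun_differentiable[OF G]]
    by (rule fun_cong[OF dderiv_add[OF smooth_fun_differentiable[OF smooth_fun_dderiv[OF F]]
      smooth_fun_differentiable[OF smooth_fun_dderiv[OF G]]]])
  then show ?thesis
    by (simp only: laplacian_left_inv_metric[OF F] laplacian_left_inv_metric[OF G]
      laplacian_left_inv_metric[OF smooth_fun_add[OF F G]] sum.distrib)
qed

text \<open>
  The normal is radial whatever the bracket is: the radial vector is horizontal at \<open>(X, Z)\<close>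
  because \<open>[X, X] = 0\<close>.
\<close>

lemma boundary_normal_left_inv_metric_iff:
  "boundary_normal (left_inv_metric J) (X, Z) \<nu> \<longleftrightarrow> (\<exists>c. \<nu> = (c *\<^sub>R X, 0))"
proof
  assume "\<exists>c. \<nu> = (c *\<^sub>R X, 0)"
  then obtain c where \<nu>: "\<nu> = (c *\<^sub>R X, 0)" by blast
  have "lie_bracket J (X, Z) (c *\<^sub>R X, 0) = c *\<^sub>R lie_bracket J (X, Z) (X, 0)"
    using linear_cmul[OF linear_lie_bracket_right, of J "(X, Z)" c "(X, 0)"] by simp
  then have "lie_bracket J (X, Z) \<nu> = 0"
    by (simp add: \<nu> lie_bracket_self)
  then show "boundary_normal (left_inv_metric J) (X, Z) \<nu>"
    by (simp add: boundary_normal_def left_inv_metric_eq[OF nil] \<nu> inner_prod_def)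
next
  assume normal: "boundary_normal (left_inv_metric J) (X, Z) \<nu>"
  let ?A = "\<lambda>u. u - (1/2) *\<^sub>R lie_bracket J (X, Z) u"
  have orth: "?A \<nu> \<bullet> w = 0" if "X \<bullet> fst w = 0" for w
  proof -
    have "lie_bracket J (X, Z) (frame_field J w (X, Z)) = lie_bracket J (X, Z) w"
      by (rule lie_bracket_cong) simp_all
    then have "?A (frame_field J w (X, Z)) = w"
      by (simp add: frame_field_def)
    then show ?thesis
      using normal that
      by (metis boundary_normal_def fst_conv fst_frame_field left_inv_metric_eq[OF nil])
  qed
  have snd0: "snd (?A \<nu>) = 0"
    using orth[of "(0, snd (?A \<nu>))"] by (simp add: inner_prod_def del: snd_diff snd_scaleR)
  let ?c = "(fst \<nu> \<bullet> X) / (X \<bullet> X)"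
  have "X \<bullet> (fst \<nu> - ?c *\<^sub>R X) = 0"
    by (cases "X = 0") (simp_all add: inner_diff_right inner_commute)
  moreover from this have "fst \<nu> \<bullet> (fst \<nu> - ?c *\<^sub>R X) = 0"
    using orth[of "(fst \<nu> - ?c *\<^sub>R X, 0)"] by (simp add: inner_prod_def)
  ultimately have "(fst \<nu> - ?c *\<^sub>R X) \<bullet> (fst \<nu> - ?c *\<^sub>R X) = 0"
    by (simp only: inner_diff_left[of "fst \<nu>"] inner_scaleR_left)
  then have fst\<nu>: "fst \<nu> = ?c *\<^sub>R X"
    by simp
  have "lie_bracket J (X, Z) \<nu> = lie_bracket J (X, Z) (?c *\<^sub>R (X, Z))"
    using fst\<nu> by (intro lie_bracket_cong) simp_all
  also have "\<dots> = 0"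
    by (simp only: linear_cmul[OF linear_lie_bracket_right] lie_bracket_self scaleR_zero_right)
  finally have "snd \<nu> = 0"
    using snd0 by simp
  with fst\<nu> show "\<exists>c. \<nu> = (c *\<^sub>R X, 0)"
    by (intro exI[of _ ?c]) (simp add: prod_eq_iff)
qed

end


section \<open>Fourier modes along the torus fibres\<close>

text \<open>
  Coordinates in which the lattice becomes the integer lattice, so that the fibre torus becomes the
  unit cube with opposite faces identified.
\<close>

lemma full_lattice_linear_image:
  fixes \<Gamma> :: "'z::euclidean_space set"
  assumes "full_lattice \<Gamma>"
  obtains L :: "'z \<Rightarrow> 'z" where "linear L" "bij L" "\<Gamma> = L ` {v. int_vector v}"
proof -
  obtain B :: "'z set" where B: "independent B" "span B = UNIV"
    and \<Gamma>: "\<Gamma> = {\<Sum>b\<in>B. of_int (k b) *\<^sub>R b | k :: 'z \<Rightarrow> int. True}"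
    using assms by (auto simp: full_lattice_def)
  have "finite B" "card B = DIM('z)"
    using B independent_imp_finite dim_eq_card[of B UNIV] by (auto simp: dim_UNIV)
  then obtain \<phi> where \<phi>: "bij_betw \<phi> (Basis :: 'z set) B"
    using finite_same_card_bij[OF finite_Basis, of B] by auto
  define L where "L x = (\<Sum>b\<in>Basis. (x \<bullet> b) *\<^sub>R \<phi> b)" for x :: 'z
  have lin: "linear L"
    unfolding L_def
    by (rule linearI) (simp_all add: inner_add_left scaleR_add_left sum.distrib scaleR_sum_right)
  have L_Basis: "L b = \<phi> b" if "b \<in> Basis" for b
    using that by (simp add: L_def inner_Basis if_distrib[of "\<lambda>r. r *\<^sub>R _"] cong: if_cong)
  have "B \<subseteq> range L"
    using \<phi> L_Basis by (metis bij_betw_imp_surj_on image_subset_iff rangeI)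
  then have "span B \<subseteq> range L"
    using lin by (intro span_minimal linear_subspace_image subspace_UNIV) auto
  then have surj: "surj L"
    using B(2) by blast
  then have bij: "bij L"
    using linear_surjective_imp_injective[OF lin] by (simp add: bij_def)
  have combination: "(\<Sum>b\<in>B. of_int (k b) *\<^sub>R b) = L (\<Sum>c\<in>Basis. of_int (k (\<phi> c)) *\<^sub>R c)" for k :: "'z \<Rightarrow> int"
  proof -
    have "(\<Sum>b\<in>B. of_int (k b) *\<^sub>R b) = (\<Sum>c\<in>Basis. of_int (k (\<phi> c)) *\<^sub>R L c)"
      using sum.reindex_bij_betw[OF \<phi>, of "\<lambda>b. of_int (k b) *\<^sub>R b"] by (simp add: L_Basis)
    then show ?thesis
      by (simp add: linear_sum[OF lin] linear_cmul[OF lin])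
  qed
  have "\<Gamma> = L ` {v. int_vector v}"
  proof (intro equalityI subsetI)
    fix x assume "x \<in> \<Gamma>"
    then obtain k where x: "x = L (\<Sum>c\<in>Basis. of_int (k (\<phi> c)) *\<^sub>R c)"
      using \<Gamma> combination by auto
    have "int_vector (\<Sum>c\<in>Basis. of_int (k (\<phi> c)) *\<^sub>R c)"
      by (simp add: int_vector_def inner_sum_left inner_Basis if_distrib cong: if_cong)
    then show "x \<in> L ` {v. int_vector v}"
      using x by blast
  next
    fix x assume "x \<in> L ` {v. int_vector v}"
    then obtain v where v: "int_vector v" "x = L v" by blast
    define k where "k b = \<lfloor>v \<bullet> inv_into Basis \<phi> b\<rfloor>" for b
    have "of_int (k (\<phi> c)) = v \<bullet> c" if "c \<in> Basis" for c
      using v(1) that bij_betw_inv_into_left[OF \<phi> that]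
      by (simp add: k_def int_vector_def)
    then have "(\<Sum>c\<in>Basis. of_int (k (\<phi> c)) *\<^sub>R c) = v"
      by (simp add: euclidean_representation)
    then have "x = (\<Sum>b\<in>B. of_int (k b) *\<^sub>R b)"
      using v(2) combination by simp
    then show "x \<in> \<Gamma>"
      using \<Gamma> by blast
  qed
  with lin bij show ?thesis by (rule that)
qed

text \<open>
  The difference of the two cosines is a product of sines of multiples of \<open>(\<gamma> + \<gamma>') \<bullet> h\<close> and
  \<open>(\<gamma>' - \<gamma>) \<bullet> h\<close>. A direction orthogonal to neither vector, scaled down until both arguments are
  less than \<open>pi\<close>, makes it nonzero.
\<close>

lemma exists_cos_inner_neq:
  fixes \<gamma> \<gamma>' :: "'z::real_inner"
  assumes "\<gamma> \<noteq> \<gamma>'" "\<gamma> \<noteq> - \<gamma>'"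
  obtains h where "cos (2 * pi * (\<gamma> \<bullet> h)) \<noteq> cos (2 * pi * (\<gamma>' \<bullet> h))"
proof -
  define p q where "p = \<gamma> + \<gamma>'" and "q = \<gamma>' - \<gamma>"
  have nz: "p \<noteq> 0" "q \<noteq> 0"
    using assms by (auto simp: p_def q_def add_eq_0_iff2)
  obtain v where v: "p \<bullet> v \<noteq> 0" "q \<bullet> v \<noteq> 0"
  proof (cases "q \<bullet> p = 0")
    case True
    then show ?thesis
      using nz by (intro that[of "p + q"]) (simp_all add: inner_add_right inner_commute)
  next
    case False
    then show ?thesis
      using nz by (intro that[of p]) simp_all
  qed
  define s where "s = 1 / (2 * (\<bar>p \<bullet> v\<bar> + \<bar>q \<bullet> v\<bar>))"
  have s: "0 < s"
    using v by (simp add: s_def add_pos_pos)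
  have sin_nz: "sin x \<noteq> 0" if "x \<noteq> 0" "\<bar>x\<bar> < pi" for x :: real
    using that sin_gt_zero[of x] sin_gt_zero[of "- x"] by (cases "x > 0") auto
  have "sin (pi * (s * (r \<bullet> v))) \<noteq> 0" if "r \<in> {p, q}" for r
  proof (rule sin_nz)
    show "pi * (s * (r \<bullet> v)) \<noteq> 0"
      using s v that by auto
    have "s * \<bar>r \<bullet> v\<bar> < 1"
      using v that by (auto simp: s_def field_simps)
    then show "\<bar>pi * (s * (r \<bullet> v))\<bar> < pi"
      using s by (simp add: abs_mult)
  qed
  moreover have "cos (2 * pi * (\<gamma> \<bullet> (s *\<^sub>R v))) - cos (2 * pi * (\<gamma>' \<bullet> (s *\<^sub>R v))) =
      2 * sin (pi * (s * (p \<bullet> v))) * sin (pi * (s * (q \<bullet> v)))"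
  proof -
    have "(2 * pi * (\<gamma> \<bullet> (s *\<^sub>R v)) + 2 * pi * (\<gamma>' \<bullet> (s *\<^sub>R v))) / 2 = pi * (s * (p \<bullet> v))"
      "(2 * pi * (\<gamma>' \<bullet> (s *\<^sub>R v)) - 2 * pi * (\<gamma> \<bullet> (s *\<^sub>R v))) / 2 = pi * (s * (q \<bullet> v))"
      by (simp_all add: p_def q_def inner_add_left inner_diff_left field_simps)
    then show ?thesis
      by (simp only: cos_diff_cos)
  qed
  ultimately show ?thesis
    by (intro that[of "s *\<^sub>R v"]) auto
qed

text \<open>
  Modes are eigenvectors of the commuting difference operators \<open>u(Z + h) + u(Z - h)\<close>, with
  eigenvalue \<open>2 * cos (2 * pi * (\<gamma> \<bullet> h))\<close>, and eigenvectors for distinct eigenvalues are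
  independent. Applying the operator minus its eigenvalue on one mode removes that mode and keeps
  the others, up to nonzero factors for suitable \<open>h\<close>.
\<close>

lemma trigonometric_modes_independent:
  fixes M :: "'z::real_inner set"
  assumes "finite M" and "\<And>\<gamma> \<gamma>'. \<gamma> \<in> M \<Longrightarrow> \<gamma>' \<in> M \<Longrightarrow> \<gamma> \<noteq> \<gamma>' \<Longrightarrow> \<gamma> \<noteq> - \<gamma>'"
    and "\<And>Z. (\<Sum>\<gamma>\<in>M. a \<gamma> * cos (2 * pi * (\<gamma> \<bullet> Z)) + b \<gamma> * sin (2 * pi * (\<gamma> \<bullet> Z))) = 0"
    and "\<gamma> \<in> M"
  shows "a \<gamma> * cos (2 * pi * (\<gamma> \<bullet> Z)) + b \<gamma> * sin (2 * pi * (\<gamma> \<bullet> Z)) = 0"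
  using assms
proof (induction M arbitrary: a b \<gamma> Z rule: finite_induct)
  case empty
  then show ?case by simp
next
  case (insert \<gamma>1 M)
  define u where "u \<gamma> Z = a \<gamma> * cos (2 * pi * (\<gamma> \<bullet> Z)) + b \<gamma> * sin (2 * pi * (\<gamma> \<bullet> Z))" for \<gamma> Z
  have wave: "u \<gamma> (Z + h) + u \<gamma> (Z - h) = 2 * cos (2 * pi * (\<gamma> \<bullet> h)) * u \<gamma> Z" for \<gamma> Z h
    by (simp add: u_def inner_add_right inner_diff_right distrib_left right_diff_distrib
        cos_add sin_add cos_diff sin_diff algebra_simps)
  have sum0: "u \<gamma>1 Z + (\<Sum>\<gamma>\<in>M. u \<gamma> Z) = 0" for Z
    using insert.prems(2)[of Z] insert.hyps by (simp add: u_def)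
  have M0: "u \<gamma> Z = 0" if "\<gamma> \<in> M" for \<gamma> Z
  proof -
    have "\<gamma> \<noteq> \<gamma>1"
      using that insert.hyps by blast
    moreover from this have "\<gamma> \<noteq> - \<gamma>1"
      using that insert.prems(1)[of \<gamma> \<gamma>1] by simp
    ultimately obtain h where h: "cos (2 * pi * (\<gamma> \<bullet> h)) \<noteq> cos (2 * pi * (\<gamma>1 \<bullet> h))"
      by (rule exists_cos_inner_neq)
    define c where "c \<gamma> = cos (2 * pi * (\<gamma> \<bullet> h)) - cos (2 * pi * (\<gamma>1 \<bullet> h))" for \<gamma>
    have "(\<Sum>\<gamma>\<in>M. c \<gamma> * u \<gamma> Z) = 0" for Z
    proof -
      have "2 * c \<gamma> * u \<gamma> Z = u \<gamma> (Z + h) + u \<gamma> (Z - h) - 2 * cos (2 * pi * (\<gamma>1 \<bullet> h)) * u \<gamma> Z" for \<gamma>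
        unfolding wave c_def by (simp add: algebra_simps)
      then have "(\<Sum>\<gamma>\<in>M. 2 * c \<gamma> * u \<gamma> Z) = (\<Sum>\<gamma>\<in>M. u \<gamma> (Z + h)) + (\<Sum>\<gamma>\<in>M. u \<gamma> (Z - h)) -
          2 * cos (2 * pi * (\<gamma>1 \<bullet> h)) * (\<Sum>\<gamma>\<in>M. u \<gamma> Z)"
        by (simp only: sum.distrib sum_subtractf sum_distrib_left)
      also have "\<dots> = - (u \<gamma>1 (Z + h) + u \<gamma>1 (Z - h)) + 2 * cos (2 * pi * (\<gamma>1 \<bullet> h)) * u \<gamma>1 Z"
      proof -
        have "(\<Sum>\<gamma>\<in>M. u \<gamma> Y) = - u \<gamma>1 Y" for Y
          using sum0[of Y] by linarith
        then show ?thesis by simp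
      qed
      also have "\<dots> = 0"
        by (simp only: wave)
      finally have "2 * (\<Sum>\<gamma>\<in>M. c \<gamma> * u \<gamma> Z) = 0"
        by (simp add: sum_distrib_left mult.assoc)
      then show ?thesis by simp
    qed
    then have "(\<Sum>\<gamma>\<in>M. (c \<gamma> * a \<gamma>) * cos (2 * pi * (\<gamma> \<bullet> Z)) + (c \<gamma> * b \<gamma>) * sin (2 * pi * (\<gamma> \<bullet> Z))) = 0" for Z
      by (simp add: u_def distrib_left mult.assoc)
    from insert.IH[OF _ this that] insert.prems(1)
    have "c \<gamma> * a \<gamma> * cos (2 * pi * (\<gamma> \<bullet> Z)) + c \<gamma> * b \<gamma> * sin (2 * pi * (\<gamma> \<bullet> Z)) = 0"
      by simp
    then have "c \<gamma> * u \<gamma> Z = 0"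
      by (simp add: u_def distrib_left mult.assoc)
    then show ?thesis
      using h by (simp add: c_def)
  qed
  then have "u \<gamma>1 Z = 0" for Z
    using sum0[of Z] by simp
  with M0 insert.prems(3) show ?case
    by (auto simp: u_def)
qed

definition dual_lattice :: "'z::euclidean_space set \<Rightarrow> 'z set" where
  "dual_lattice \<Gamma> = {\<gamma>. \<forall>v\<in>\<Gamma>. \<gamma> \<bullet> v \<in> \<int>}"

text \<open>
  The part of \<open>f\<close> of frequency \<open>\<plusminus>\<gamma>\<close> along the fibre, up to a constant factor, composed with \<open>R\<close>
  on the base. The cosine instead of the complex exponential keeps the function real.
\<close>

definition twisted_mode ::
  "('z::euclidean_space \<Rightarrow> 'z) \<Rightarrow> 'z \<Rightarrow> ('v \<Rightarrow> 'v) \<Rightarrow> ('v \<times> 'z \<Rightarrow> real) \<Rightarrow> 'v \<times> 'z \<Rightarrow> real" where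
  "twisted_mode L \<gamma> R f p =
     integral (cbox 0 One) (\<lambda>t. f (R (fst p), L t) * cos (2 * pi * (\<gamma> \<bullet> (L t - snd p))))"

lemma twisted_mode_scale: "twisted_mode L \<gamma> R (\<lambda>x. c * f x) = (\<lambda>p. c * twisted_mode L \<gamma> R f p)"
  by (simp add: twisted_mode_def fun_eq_iff mult.assoc)

text \<open>
  Extending by zero outside the ball destroys smoothness, but the restrictions to single fibres stay
  continuous and periodic, as the Fourier analysis along the fibres requires.
\<close>

definition slice_continuous_periodic :: "'z::euclidean_space set \<Rightarrow> ('v \<times> 'z \<Rightarrow> real) set" where
  "slice_continuous_periodic \<Gamma> =
     {f. lattice_periodic \<Gamma> f \<and> (\<forall>X. continuous_on UNIV (\<lambda>Z. f (X, Z)))}"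

lemma subspace_slice_continuous_periodic: "fun_space.subspace (slice_continuous_periodic \<Gamma>)"
  unfolding fun_space.subspace_def slice_continuous_periodic_def lattice_periodic_def
  by (auto intro: continuous_intros)

context
  fixes \<Gamma> :: "'z::euclidean_space set" and L :: "'z \<Rightarrow> 'z"
  assumes L: "linear L" "bij L" and \<Gamma>: "\<Gamma> = L ` {v. int_vector v}"
begin

lemma continuous_on_lattice_map: "continuous_on S L"
  using L(1) by (intro linear_continuous_on) (simp add: linear_conv_bounded_linear)

lemma lattice_map_inv [simp]: "L (inv L Z) = Z"
  using L(2) by (simp add: bij_is_surj surj_f_inv_f)

lemma lattice_map_Basis: "b \<in> Basis \<Longrightarrow> L b \<in> \<Gamma>"
  unfolding \<Gamma> using int_vector_Basis by blast

lemma unit_periodic_slice: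
  assumes "lattice_periodic \<Gamma> f"
  shows "unit_periodic (\<lambda>t. f (X, Z + L t))"
  using assms lattice_map_Basis
  by (simp add: unit_periodic_def lattice_periodic_def linear_add[OF L(1)] flip: add.assoc)

lemma continuous_on_slice:
  assumes "f \<in> slice_continuous_periodic \<Gamma>"
  shows "continuous_on S (\<lambda>t. f (X, L t))"
proof -
  have "continuous_on UNIV (\<lambda>Z. f (X, Z))"
    using assms by (simp add: slice_continuous_periodic_def)
  from continuous_on_compose2[OF this continuous_on_lattice_map] show ?thesis
    by simp
qed

lemma continuous_on_twisted_mode_integrand:
  assumes "f \<in> slice_continuous_periodic \<Gamma>"
  shows "continuous_on S (\<lambda>t. f (X, L t) * cos (2 * pi * (\<gamma> \<bullet> (L t - Z))))"
    and "continuous_on S (\<lambda>t. f (X, L t) * sin (2 * pi * (\<gamma> \<bullet> (L t - Z))))"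
  by (intro continuous_on_mult continuous_on_slice[OF assms] continuous_intros
      continuous_on_lattice_map)+

lemma twisted_mode_add:
  assumes "f \<in> slice_continuous_periodic \<Gamma>" "g \<in> slice_continuous_periodic \<Gamma>"
  shows "twisted_mode L \<gamma> R (f + g) = twisted_mode L \<gamma> R f + twisted_mode L \<gamma> R g"
  using integral_add[OF integrable_continuous[OF continuous_on_twisted_mode_integrand(1)[OF assms(1)]]
      integrable_continuous[OF continuous_on_twisted_mode_integrand(1)[OF assms(2)]]]
  by (simp add: twisted_mode_def fun_eq_iff distrib_right)

lemma twisted_mode_eq_trigonometric:
  assumes f: "f \<in> slice_continuous_periodic \<Gamma>"
  shows "twisted_mode L \<gamma> R f (X, Z) =
    twisted_mode L \<gamma> R f (X, 0) * cos (2 * pi * (\<gamma> \<bullet> Z)) +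
    integral (cbox 0 One) (\<lambda>t. f (R X, L t) * sin (2 * pi * (\<gamma> \<bullet> L t))) * sin (2 * pi * (\<gamma> \<bullet> Z))"
proof -
  let ?c = "\<lambda>t. f (R X, L t) * cos (2 * pi * (\<gamma> \<bullet> L t))"
  let ?s = "\<lambda>t. f (R X, L t) * sin (2 * pi * (\<gamma> \<bullet> L t))"
  have int: "?c integrable_on cbox 0 One" "?s integrable_on cbox 0 One"
    using continuous_on_twisted_mode_integrand[OF f, where Z = 0]
    by (simp_all add: integrable_continuous)
  have "twisted_mode L \<gamma> R f (X, Z) = integral (cbox 0 One)
      (\<lambda>t. ?c t * cos (2 * pi * (\<gamma> \<bullet> Z)) + ?s t * sin (2 * pi * (\<gamma> \<bullet> Z)))"
    by (simp add: twisted_mode_def inner_diff_right right_diff_distrib cos_diff algebra_simps)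
  also have "\<dots> = integral (cbox 0 One) (\<lambda>t. ?c t * cos (2 * pi * (\<gamma> \<bullet> Z))) +
      integral (cbox 0 One) (\<lambda>t. ?s t * sin (2 * pi * (\<gamma> \<bullet> Z)))"
    by (intro integral_add integrable_on_mult_left int)
  also have "\<dots> = integral (cbox 0 One) ?c * cos (2 * pi * (\<gamma> \<bullet> Z)) +
      integral (cbox 0 One) ?s * sin (2 * pi * (\<gamma> \<bullet> Z))"
    by (simp only: integral_mult_left)
  finally show ?thesis
    by (simp add: twisted_mode_def)
qed

text \<open>
  If all modes vanish, the fibre restrictions of \<open>f\<close> have no Fourier coefficients. One vector out of
  each pair \<open>\<plusminus>\<gamma>\<close> suffices, as both give the same cosine and opposite sine coefficients.
\<close>

lemma twisted_modes_separate:
  fixes f :: "'v \<times> 'z \<Rightarrow> real"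
  assumes f: "f \<in> slice_continuous_periodic \<Gamma>"
    and I: "\<And>\<gamma>. \<gamma> \<in> dual_lattice \<Gamma> \<Longrightarrow> \<gamma> \<in> I \<or> - \<gamma> \<in> I"
    and R: "\<And>\<gamma>. surj (R \<gamma>)"
    and zero: "\<And>\<gamma>. \<gamma> \<in> I \<Longrightarrow> twisted_mode L \<gamma> (R \<gamma>) f = 0"
  shows "f = 0"
proof (rule ext)
  fix p :: "'v \<times> 'z"
  obtain X Z where p: "p = (X, Z)" by fastforce
  have coeff: "integral (cbox 0 One) (\<lambda>t. f (X, L t) * cos (2 * pi * (\<gamma> \<bullet> L t))) = 0"
    "integral (cbox 0 One) (\<lambda>t. f (X, L t) * sin (2 * pi * (\<gamma> \<bullet> L t))) = 0" if "\<gamma> \<in> I" for \<gamma>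
  proof -
    obtain X' where X': "R \<gamma> X' = X"
      using R by (metis surjD)
    have tm: "twisted_mode L \<gamma> (R \<gamma>) f (X', Y) = 0" for Y
      using zero[OF that] by simp
    show "integral (cbox 0 One) (\<lambda>t. f (X, L t) * cos (2 * pi * (\<gamma> \<bullet> L t))) = 0"
      using tm[of 0] by (simp add: twisted_mode_def X')
    show "integral (cbox 0 One) (\<lambda>t. f (X, L t) * sin (2 * pi * (\<gamma> \<bullet> L t))) = 0"
    proof (cases "\<gamma> = 0")
      case False
      \<comment> \<open>A quarter period along \<open>\<gamma>\<close> turns the cosine coefficient into the sine coefficient.\<close>
      then have "2 * pi * (\<gamma> \<bullet> ((1 / (4 * (\<gamma> \<bullet> \<gamma>))) *\<^sub>R \<gamma>)) = pi / 2"
        by simp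
      then show ?thesis
        using tm[of "(1 / (4 * (\<gamma> \<bullet> \<gamma>))) *\<^sub>R \<gamma>"] tm[of 0]
        unfolding twisted_mode_eq_trigonometric[OF f, of _ _ _ "(1 / (4 * (\<gamma> \<bullet> \<gamma>))) *\<^sub>R \<gamma>"]
        by (simp only: X') simp
    qed simp
  qed
  let ?u = "\<lambda>t. f (X, L t)"
  have "unit_periodic ?u"
    using unit_periodic_slice[of f X 0] f by (simp add: slice_continuous_periodic_def)
  moreover have "fourier_annihilated ?u"
    unfolding fourier_annihilated_def
  proof (intro conjI allI impI)
    show "continuous_on UNIV ?u"
      by (rule continuous_on_slice[OF f])
    fix m :: 'z assume m: "int_vector m"
    obtain G where G: "linear G" "G \<circ> L = id"
      using linear_injective_left_inverse[OF L(1) bij_is_inj[OF L(2)]] by blast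
    define \<gamma> where "\<gamma> = adjoint G m"
    have \<gamma>: "\<gamma> \<bullet> L t = m \<bullet> t" for t
      using fun_cong[OF G(2), of t] by (simp add: \<gamma>_def adjoint_clauses[OF G(1)])
    have "\<gamma> \<in> dual_lattice \<Gamma>"
    proof -
      have "m \<bullet> v \<in> \<int>" if "int_vector v" for v
      proof -
        have "(\<Sum>b\<in>Basis. (m \<bullet> b) * (v \<bullet> b)) \<in> \<int>"
          using m that by (intro Ints_sum Ints_mult) (auto simp: int_vector_def)
        then show ?thesis
          by (simp flip: euclidean_inner)
      qed
      then show ?thesis
        by (auto simp: dual_lattice_def \<Gamma> \<gamma>)
    qed
    then consider "\<gamma> \<in> I" | "- \<gamma> \<in> I"
      using I by blast
    then have "integral (cbox 0 One) (\<lambda>t. ?u t * cos (2 * pi * (\<gamma> \<bullet> L t))) = 0 \<and>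
      integral (cbox 0 One) (\<lambda>t. ?u t * sin (2 * pi * (\<gamma> \<bullet> L t))) = 0"
      using coeff[of \<gamma>] coeff[of "- \<gamma>"] by cases simp_all
    then show "integral (cbox 0 One) (\<lambda>t. ?u t * cos (2 * pi * (m \<bullet> t))) = 0"
      "integral (cbox 0 One) (\<lambda>t. ?u t * sin (2 * pi * (m \<bullet> t))) = 0"
      by (simp_all add: \<gamma>)
  qed
  ultimately have "f (X, L (inv L Z)) = 0"
    by (rule fourier_coefficients_zero_imp_zero)
  then show "f p = 0 p"
    by (simp add: p)
qed

lemma twisted_modes_independent:
  fixes f :: "'v \<times> 'z \<Rightarrow> real"
  assumes f: "f \<in> slice_continuous_periodic \<Gamma>" and M: "finite M"
    and antipodal: "\<And>\<gamma> \<gamma>'. \<gamma> \<in> M \<Longrightarrow> \<gamma>' \<in> M \<Longrightarrow> \<gamma> \<noteq> \<gamma>' \<Longrightarrow> \<gamma> \<noteq> - \<gamma>'"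
    and sum: "(\<Sum>\<gamma>\<in>M. twisted_mode L \<gamma> (R \<gamma>) f) = 0" and \<gamma>: "\<gamma> \<in> M"
  shows "twisted_mode L \<gamma> (R \<gamma>) f = 0"
proof (rule ext)
  fix p :: "'v \<times> 'z"
  obtain X Z where p: "p = (X, Z)" by fastforce
  define a b where "a \<gamma> = twisted_mode L \<gamma> (R \<gamma>) f (X, 0)"
    and "b \<gamma> = integral (cbox 0 One) (\<lambda>t. f (R \<gamma> X, L t) * sin (2 * pi * (\<gamma> \<bullet> L t)))" for \<gamma>
  have mode: "twisted_mode L \<gamma> (R \<gamma>) f (X, Y) =
      a \<gamma> * cos (2 * pi * (\<gamma> \<bullet> Y)) + b \<gamma> * sin (2 * pi * (\<gamma> \<bullet> Y))" for \<gamma> Y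
    unfolding a_def b_def by (rule twisted_mode_eq_trigonometric[OF f])
  have "(\<Sum>\<gamma>\<in>M. a \<gamma> * cos (2 * pi * (\<gamma> \<bullet> Y)) + b \<gamma> * sin (2 * pi * (\<gamma> \<bullet> Y))) = 0" for Y
    using fun_cong[OF sum, of "(X, Y)"] by (simp add: sum_fun_apply mode)
  from trigonometric_modes_independent[OF M antipodal this \<gamma>]
  show "twisted_mode L \<gamma> (R \<gamma>) f p = 0 p"
    by (simp add: p mode)
qed

end


section \<open>Rotating the base in a single mode\<close>

lemma surj_orthogonal_transformation:
  fixes R :: "'v::euclidean_space \<Rightarrow> 'v"
  assumes "orthogonal_transformation R" shows "surj R"
proof (rule linear_injective_imp_surjective[OF orthogonal_transformation_linear[OF assms]])
  show "inj R"
    using orthogonal_transformation_inj[OF assms] .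
qed (rule refl)

lemma sum_Basis_prod:
  fixes h :: "'a::euclidean_space \<times> 'b::euclidean_space \<Rightarrow> real"
  shows "(\<Sum>b\<in>Basis. h b) = (\<Sum>c\<in>Basis. h (c, 0)) + (\<Sum>d\<in>Basis. h (0, d))"
proof -
  have "inj_on (\<lambda>c. (c :: 'a, 0 :: 'b)) Basis" "inj_on (\<lambda>d. (0 :: 'a, d :: 'b)) Basis"
    by (auto intro!: inj_onI)
  moreover have "(\<lambda>c. (c :: 'a, 0 :: 'b)) ` Basis \<inter> (\<lambda>d. (0, d)) ` Basis = {}"
    by auto
  ultimately show ?thesis
    unfolding Basis_prod_def by (subst sum.union_disjoint) (simp_all add: sum.reindex)
qed

text \<open>
  The trace of a bilinear form does not depend on the orthonormal basis.
\<close>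

lemma sum_Basis_orthogonal_transformation:
  fixes H :: "'v::euclidean_space \<Rightarrow> 'v \<Rightarrow> real" and R :: "'v \<Rightarrow> 'v"
  assumes R: "orthogonal_transformation R"
    and H: "\<And>y. linear (\<lambda>x. H x y)" "\<And>x. linear (H x)"
  shows "(\<Sum>c\<in>Basis. H (R c) (R c)) = (\<Sum>c\<in>Basis. H c c)"
proof -
  obtain R' where R': "R (R' x) = x" for x
    using surj_orthogonal_transformation[OF R] by (metis surj_f_inv_f)
  have move: "R x \<bullet> y = x \<bullet> R' y" for x y
    using R by (metis R' orthogonal_transformation_def)
  have "H (R c) (R c) = (\<Sum>d\<in>Basis. \<Sum>e\<in>Basis. (R' d \<bullet> c) * (R' e \<bullet> c) * H d e)" for c
  proof -
    have "H (R c) (R c) = (\<Sum>d\<in>Basis. (R c \<bullet> d) * H d (R c))"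
      by (rule sum_Basis_linear_functional[OF H(1), symmetric])
    also have "\<dots> = (\<Sum>d\<in>Basis. (R c \<bullet> d) * (\<Sum>e\<in>Basis. (R c \<bullet> e) * H d e))"
      by (simp only: sum_Basis_linear_functional[OF H(2)])
    finally show ?thesis
      by (simp only: move inner_commute[of c] sum_distrib_left mult.assoc)
  qed
  then have "(\<Sum>c\<in>Basis. H (R c) (R c)) =
      (\<Sum>c\<in>Basis. \<Sum>d\<in>Basis. \<Sum>e\<in>Basis. (R' d \<bullet> c) * (R' e \<bullet> c) * H d e)"
    by simp
  also have "\<dots> = (\<Sum>d\<in>Basis. \<Sum>c\<in>Basis. \<Sum>e\<in>Basis. (R' d \<bullet> c) * (R' e \<bullet> c) * H d e)"
    by (rule sum.swap)
  also have "\<dots> = (\<Sum>d\<in>Basis. \<Sum>e\<in>Basis. \<Sum>c\<in>Basis. (R' d \<bullet> c) * (R' e \<bullet> c) * H d e)"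
    by (rule sum.cong[OF refl], rule sum.swap)
  also have "\<dots> = (\<Sum>d\<in>Basis. \<Sum>e\<in>Basis. (d \<bullet> e) * H d e)"
  proof (intro sum.cong refl)
    fix d e :: 'v
    have "(\<Sum>c\<in>Basis. (R' d \<bullet> c) * (R' e \<bullet> c) * H d e) = (R' d \<bullet> R' e) * H d e"
      by (simp only: euclidean_inner[of "R' d" "R' e"] sum_distrib_right)
    also have "R' d \<bullet> R' e = d \<bullet> e"
      using move[of "R' d" e] by (simp add: R')
    finally show "(\<Sum>c\<in>Basis. (R' d \<bullet> c) * (R' e \<bullet> c) * H d e) = (d \<bullet> e) * H d e" .
  qed
  also have "\<dots> = (\<Sum>d\<in>Basis. H d d)"
    by (simp only: sum_Basis_linear_functional[OF H(2)])
  finally show ?thesis .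
qed

lemma dderiv_invariant_direction:
  assumes G: "smooth_fun G" and inv: "\<And>c. G (q + c *\<^sub>R w) = G q"
  shows "dderiv G w q = 0"
proof -
  have "((\<lambda>c. q + c *\<^sub>R w) has_derivative (\<lambda>c. c *\<^sub>R w)) (at (0::real))"
    by (auto intro!: derivative_eq_intros)
  moreover have "(G has_derivative frechet_derivative G (at q)) (at (q + 0 *\<^sub>R w))"
    using has_derivative_frechet[OF smooth_fun_differentiable[OF G], of q] by simp
  ultimately have "((\<lambda>c. G (q + c *\<^sub>R w)) has_derivative (\<lambda>c. dderiv G (c *\<^sub>R w) q)) (at (0::real))"
    by (rule has_derivative_compose)
  moreover have "((\<lambda>c. G (q + c *\<^sub>R w)) has_derivative (\<lambda>c. 0)) (at (0::real))"
    by (simp add: inv)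
  ultimately have "(\<lambda>c. dderiv G (c *\<^sub>R w) q) = (\<lambda>c::real. 0)"
    by (rule has_derivative_unique)
  from fun_cong[OF this, of 1] show ?thesis by simp
qed

lemma dderiv_translation_invariant:
  assumes G: "smooth_fun G" and inv: "\<And>q. G (q + w) = G q"
  shows "dderiv G u (q + w) = dderiv G u q"
proof -
  have "((\<lambda>q. q + w) has_derivative (\<lambda>u. u)) (at q)"
    by (auto intro!: derivative_eq_intros)
  from has_derivative_compose[OF this has_derivative_frechet[OF smooth_fun_differentiable[OF G]]]
  have "(G has_derivative frechet_derivative G (at (q + w))) (at q)"
    by (simp add: inv)
  then show ?thesis
    by (rule dderiv_eqI[symmetric])
qed

text \<open>
  The invariance of \<open>G\<close> says that \<open>G\<close> varies along the fibres in the direction \<open>\<gamma>\<close> only, so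
  second derivatives of \<open>G\<close> see a frame vector only through its horizontal part \<open>c\<close> and the number
  \<open>\<gamma> \<bullet> [X, c]\<close>. By the relation between \<open>R\<close>, \<open>\<sigma>\<close> and \<open>J \<gamma>\<close>, the rotation takes these data for \<open>c\<close> in
  the deformed algebra to the data for \<open>R c\<close> in the original one, and the sum over the
  rotated basis is the sum over the basis.
\<close>

lemma laplacian_sigma_deform_compose:
  fixes J :: "'z::euclidean_space \<Rightarrow> 'v::euclidean_space \<Rightarrow> 'v"
  assumes J: "metric_two_step_nilpotent J" and J': "metric_two_step_nilpotent (sigma_deform \<sigma> J)"
    and R: "orthogonal_transformation R" and JR: "\<And>X. J \<gamma> (R X) = R (\<sigma> (J \<gamma> X))"
    and G: "smooth_fun G" and inv: "\<And>q W. \<gamma> \<bullet> W = 0 \<Longrightarrow> G (q + (0, W)) = G q"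
  shows "laplacian (left_inv_metric (sigma_deform \<sigma> J)) (\<lambda>p. G (R (fst p), snd p)) (X, Z) =
    laplacian (left_inv_metric J) G (R X, Z)"
proof -
  let ?M = "\<lambda>p :: 'v \<times> 'z. (R (fst p), snd p)" and ?q = "(R X, Z)"
  have linR: "linear R"
    by (rule orthogonal_transformation_linear[OF R])
  have linM: "linear ?M"
    by (rule linearI) (simp_all add: linear_add[OF linR] linear_cmul[OF linR])
  have vertical: "dderiv G (0, W) q = 0" "dderiv2 G u (0, W) q = 0" if W: "\<gamma> \<bullet> W = 0" for W q u
  proof -
    have cW: "\<gamma> \<bullet> (c *\<^sub>R W) = 0" for c
      using W by simp
    have eq: "c *\<^sub>R (0 :: 'v, W) = (0, c *\<^sub>R W)" for c
      by simp
    show "dderiv G (0, W) q = 0"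
      by (rule dderiv_invariant_direction[OF G], unfold eq, rule inv[OF cW])
    show "dderiv2 G u (0, W) q = 0"
      by (rule dderiv_invariant_direction[OF smooth_fun_dderiv[OF G]], unfold eq,
          rule dderiv_translation_invariant[OF G], rule inv[OF cW])
  qed
  have D2: "dderiv2 G (x, y) (x, y) q = dderiv2 G (x, y') (x, y') q" if "\<gamma> \<bullet> y = \<gamma> \<bullet> y'" for x y y' q
  proof -
    have 0: "\<gamma> \<bullet> (y - y') = 0"
      using that by (simp add: inner_diff_right)
    have eq: "(x, y) = (x, y') + (0, y - y')"
      by simp
    have "dderiv G (x, y) = dderiv G (x, y')"
      by (rule ext) (simp only: eq linear_add[OF linear_dderiv[OF G]] vertical(1)[OF 0] add_0_right)
    moreover have "dderiv2 G u (x, y) q = dderiv2 G u (x, y') q" for u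
      by (simp only: eq linear_add[OF linear_dderiv2_right[OF G]] vertical(2)[OF 0] add_0_right)
    ultimately show ?thesis by simp
  qed
  define H where "H x y = dderiv2 G (frame_field J (x, 0) ?q) (frame_field J (y, 0) ?q) ?q" for x y
  have linF: "linear (\<lambda>x. frame_field J (x, 0) ?q)"
    using linear_compose[OF _ linear_frame_field, of "\<lambda>x. (x, 0)" J ?q]
    by (simp add: o_def linear_iff)
  have H: "linear (\<lambda>x. H x y)" "linear (H x)" for x y
    using linear_compose[OF linF linear_dderiv2_left[OF G]]
      linear_compose[OF linF linear_dderiv2_right[OF G]]
    by (simp_all add: H_def[abs_def] o_def)
  have compose: "dderiv2 (\<lambda>p. G (?M p)) u u p = dderiv2 G (?M u) (?M u) (?M p)" for u p
    unfolding dderiv_compose_linear[OF smooth_fun_differentiable[OF G] linM]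
    by (rule fun_cong[OF dderiv_compose_linear[OF smooth_fun_differentiable[OF
      smooth_fun_dderiv[OF G]] linM]])
  have horizontal: "dderiv2 G (?M (frame_field (sigma_deform \<sigma> J) (c, 0) (X, Z)))
      (?M (frame_field (sigma_deform \<sigma> J) (c, 0) (X, Z))) ?q = H (R c) (R c)" for c
  proof -
    have iso: "R x \<bullet> R y = x \<bullet> y" for x y
      using R by (simp add: orthogonal_transformation_def)
    have "\<gamma> \<bullet> snd (frame_field (sigma_deform \<sigma> J) (c, 0) (X, Z)) =
        \<gamma> \<bullet> snd (frame_field J (R c, 0) ?q)"
      using inner_snd_lie_bracket[OF J, of ?q "(R c, 0)" \<gamma>]
        inner_snd_lie_bracket[OF J', of "(X, Z)" "(c, 0)" \<gamma>]
      by (simp add: frame_field_def inner_commute[of \<gamma>] JR iso sigma_deform_def)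
    note same = D2[OF this, of "R c" ?q]
    have pair: "(R c, snd (frame_field J (R c, 0) ?q)) = frame_field J (R c, 0) ?q"
      by (simp add: prod_eq_iff)
    show ?thesis
      using same unfolding pair by (simp only: H_def fst_frame_field fst_conv)
  qed
  have "laplacian (left_inv_metric (sigma_deform \<sigma> J)) (\<lambda>p. G (?M p)) (X, Z) =
      (\<Sum>b\<in>Basis. dderiv2 G (?M (frame_field (sigma_deform \<sigma> J) b (X, Z)))
        (?M (frame_field (sigma_deform \<sigma> J) b (X, Z))) ?q)"
    by (simp only: laplacian_left_inv_metric[OF J' smooth_fun_compose_linear[OF linM G]] compose fst_conv snd_conv)
  also have "\<dots> = (\<Sum>c\<in>Basis. H (R c) (R c)) + (\<Sum>d\<in>Basis. dderiv2 G (0, d) (0, d) ?q)"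
    by (simp only: sum_Basis_prod horizontal)
      (simp add: frame_field_def linear_0[OF linR])
  also have "(\<Sum>c\<in>Basis. H (R c) (R c)) = (\<Sum>c\<in>Basis. H c c)"
    by (rule sum_Basis_orthogonal_transformation[OF R H])
  also have "\<dots> + (\<Sum>d\<in>Basis. dderiv2 G (0, d) (0, d) ?q) = laplacian (left_inv_metric J) G ?q"
    by (simp add: laplacian_left_inv_metric[OF J G] sum_Basis_prod H_def frame_field_def)
  finally show ?thesis .
qed


section \<open>Isospectrality\<close>

lemma restrict_ball_in_slice_continuous_periodic:
  fixes F :: "'v::euclidean_space \<times> 'z::euclidean_space \<Rightarrow> real"
  assumes "smooth_fun F" "lattice_periodic \<Gamma> F"
  shows "restrict_ball \<delta> F \<in> slice_continuous_periodic \<Gamma>"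
proof -
  have "continuous_on UNIV (\<lambda>Z. F (X, Z))" for X
    by (rule continuous_on_compose2[OF smooth_fun_continuous[OF assms(1), of UNIV]
          continuous_on_Pair[OF continuous_on_const continuous_on_id]]) simp
  then have "continuous_on UNIV (\<lambda>Z. restrict_ball \<delta> F (X, Z))" for X
    by (cases "X \<in> cball 0 \<delta>") (simp_all add: restrict_ball_def)
  with assms(2) show ?thesis
    by (simp add: slice_continuous_periodic_def lattice_periodic_def restrict_ball_def)
qed

lemma restrict_ball_add: "restrict_ball \<delta> F + restrict_ball \<delta> G = restrict_ball \<delta> (\<lambda>p. F p + G p)"
  by (simp add: restrict_ball_def fun_eq_iff)

lemma restrict_ball_0: "restrict_ball \<delta> (\<lambda>p. 0) = 0"
  by (simp add: restrict_ball_def fun_eq_iff)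

lemma lattice_periodic_add:
  "lattice_periodic \<Gamma> F \<Longrightarrow> lattice_periodic \<Gamma> G \<Longrightarrow> lattice_periodic \<Gamma> (\<lambda>p. F p + G p)"
  by (simp add: lattice_periodic_def)

context
  fixes J :: "'z::euclidean_space \<Rightarrow> 'v::euclidean_space \<Rightarrow> 'v"
  assumes nil: "metric_two_step_nilpotent J"
begin

lemma laplacian_const_0: "laplacian (left_inv_metric J) (\<lambda>p. 0) q = 0"
  by (simp add: laplacian_left_inv_metric[OF nil smooth_fun_const])

lemma dirichlet_eigenspace_0: "0 \<in> dirichlet_eigenspace \<Gamma> \<delta> (left_inv_metric J) \<mu>"
  unfolding dirichlet_eigenspace_def
  by (rule CollectI, rule exI[of _ "\<lambda>p. 0"])
    (simp add: restrict_ball_0 smooth_fun_const lattice_periodic_def laplacian_const_0)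

lemma neumann_eigenspace_0: "0 \<in> neumann_eigenspace \<Gamma> \<delta> (left_inv_metric J) \<mu>"
  unfolding neumann_eigenspace_def
  by (rule CollectI, rule exI[of _ "\<lambda>p. 0"])
    (simp add: restrict_ball_0 smooth_fun_const lattice_periodic_def laplacian_const_0)

lemma dirichlet_eigenspace_add:
  assumes "f \<in> dirichlet_eigenspace \<Gamma> \<delta> (left_inv_metric J) \<mu>"
    and "g \<in> dirichlet_eigenspace \<Gamma> \<delta> (left_inv_metric J) \<mu>"
  shows "f + g \<in> dirichlet_eigenspace \<Gamma> \<delta> (left_inv_metric J) \<mu>"
proof -
  obtain F G where F: "f = restrict_ball \<delta> F" "smooth_fun F" "lattice_periodic \<Gamma> F"
      "\<forall>p \<in> ball 0 \<delta> \<times> UNIV. laplacian (left_inv_metric J) F p = - \<mu> * F p"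
      "\<forall>p \<in> sphere 0 \<delta> \<times> UNIV. F p = 0"
    and G: "g = restrict_ball \<delta> G" "smooth_fun G" "lattice_periodic \<Gamma> G"
      "\<forall>p \<in> ball 0 \<delta> \<times> UNIV. laplacian (left_inv_metric J) G p = - \<mu> * G p"
      "\<forall>p \<in> sphere 0 \<delta> \<times> UNIV. G p = 0"
    using assms unfolding dirichlet_eigenspace_def by blast
  show ?thesis
    unfolding dirichlet_eigenspace_def F(1) G(1) restrict_ball_add
    by (rule CollectI, rule exI[of _ "\<lambda>p. F p + G p"])
      (use F(2-) G(2-) in \<open>simp add: smooth_fun_add lattice_periodic_add laplacian_add[OF nil] distrib_left\<close>)
qed

lemma neumann_eigenspace_add:
  assumes "f \<in> neumann_eigenspace \<Gamma> \<delta> (left_inv_metric J) \<mu>"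
    and "g \<in> neumann_eigenspace \<Gamma> \<delta> (left_inv_metric J) \<mu>"
  shows "f + g \<in> neumann_eigenspace \<Gamma> \<delta> (left_inv_metric J) \<mu>"
proof -
  obtain F G where F: "f = restrict_ball \<delta> F" "smooth_fun F" "lattice_periodic \<Gamma> F"
      "\<forall>p \<in> ball 0 \<delta> \<times> UNIV. laplacian (left_inv_metric J) F p = - \<mu> * F p"
      "\<forall>p \<in> sphere 0 \<delta> \<times> UNIV. \<forall>\<nu>. boundary_normal (left_inv_metric J) p \<nu> \<longrightarrow> dderiv F \<nu> p = 0"
    and G: "g = restrict_ball \<delta> G" "smooth_fun G" "lattice_periodic \<Gamma> G"
      "\<forall>p \<in> ball 0 \<delta> \<times> UNIV. laplacian (left_inv_metric J) G p = - \<mu> * G p"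
      "\<forall>p \<in> sphere 0 \<delta> \<times> UNIV. \<forall>\<nu>. boundary_normal (left_inv_metric J) p \<nu> \<longrightarrow> dderiv G \<nu> p = 0"
    using assms unfolding neumann_eigenspace_def by blast
  have "dderiv (\<lambda>p. F p + G p) \<nu> p = dderiv F \<nu> p + dderiv G \<nu> p" for \<nu> p
    by (rule fun_cong[OF dderiv_add[OF smooth_fun_differentiable[OF F(2)] smooth_fun_differentiable[OF G(2)]]])
  then show ?thesis
    unfolding neumann_eigenspace_def F(1) G(1) restrict_ball_add
    by (intro CollectI exI[of _ "\<lambda>p. F p + G p"])
      (use F(2-) G(2-) in \<open>simp add: smooth_fun_add lattice_periodic_add laplacian_add[OF nil] distrib_left\<close>)
qed

end

context
  fixes \<Gamma> :: "'z::euclidean_space set" and L :: "'z \<Rightarrow> 'z" and \<gamma> :: 'z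
  assumes L: "linear L" "bij L" and \<Gamma>: "\<Gamma> = L ` {v. int_vector v}" and \<gamma>: "\<gamma> \<in> dual_lattice \<Gamma>"
begin

abbreviation mode_projection :: "('v::euclidean_space \<times> 'z \<Rightarrow> real) \<Rightarrow> 'v \<times> 'z \<Rightarrow> real" where
  "mode_projection \<equiv> translate_average (\<lambda>t. (0, L t)) (\<lambda>t. cos (2 * pi * (\<gamma> \<bullet> L t)))"

lemma continuous_on_mode_projection_data:
  "continuous_on UNIV (\<lambda>t. (0 :: 'v::euclidean_space, L t))"
  "continuous_on UNIV (\<lambda>t. cos (2 * pi * (\<gamma> \<bullet> L t)))"
  by (intro continuous_intros continuous_on_lattice_map[OF L \<Gamma>])+

lemmas smooth_fun_mode_projection = smooth_fun_translate_average[OF continuous_on_mode_projection_data]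
lemmas dderiv_mode_projection = dderiv_translate_average[OF continuous_on_mode_projection_data]

lemma mode_projection_eq_0:
  assumes "\<And>Y. f (fst p, Y) = 0" shows "mode_projection f p = 0"
proof -
  have "f (p + (0, W)) = 0" for W
    using assms[of "snd p + W"] by (cases p) simp
  then show ?thesis
    by (simp add: translate_average_def)
qed

lemma lattice_periodic_mode_projection:
  assumes "lattice_periodic \<Gamma> F" shows "lattice_periodic \<Gamma> (mode_projection F)"
proof -
  have "F (X, Z + v + L t) = F (X, Z + L t)" if "v \<in> \<Gamma>" for X Z v t
    using assms that unfolding lattice_periodic_def by (metis add.assoc add.commute)
  then show ?thesis
    by (simp add: lattice_periodic_def translate_average_def)
qed

text \<open>
  The left-hand side integrates over the whole fibre against a kernel depending on the point, the
  right-hand side averages translates with a fixed weight. They agree by translation invariance of the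
  integral over a period. The first form gives the dependence on the fibre variable, the second
  one gives smoothness and the eigenvalue equation.
\<close>

lemma twisted_mode_eq_mode_projection:
  fixes F :: "'v::euclidean_space \<times> 'z \<Rightarrow> real"
  assumes F: "smooth_fun F" "lattice_periodic \<Gamma> F"
  shows "twisted_mode L \<gamma> R F p = mode_projection F (R (fst p), snd p)"
proof -
  obtain X Z where p: "p = (X, Z)" by fastforce
  let ?g = "\<lambda>t. F (R X, L t) * cos (2 * pi * (\<gamma> \<bullet> (L t - Z)))"
  have per: "unit_periodic ?g"
  proof -
    have "cos (2 * pi * (\<gamma> \<bullet> (L (t + e) - Z))) = cos (2 * pi * (\<gamma> \<bullet> (L t - Z)))" if "e \<in> Basis" for t e
    proof -
      have "\<gamma> \<bullet> L e \<in> \<int>"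
        using \<gamma> lattice_map_Basis[OF L \<Gamma> that] by (simp add: dual_lattice_def)
      then obtain n where "\<gamma> \<bullet> L e = of_int n"
        by (rule Ints_cases)
      then have "2 * pi * (\<gamma> \<bullet> (L (t + e) - Z)) = 2 * pi * (\<gamma> \<bullet> (L t - Z)) + 2 * pi * of_int n"
        by (simp add: linear_add[OF L(1)] inner_add_right inner_diff_right algebra_simps)
      then show ?thesis
        by (simp only: cos_add) simp
    qed
    then show ?thesis
      using unit_periodic_slice[OF L \<Gamma> F(2), of "R X" 0] by (simp add: unit_periodic_def)
  qed
  have "continuous_on UNIV (\<lambda>t. (R X, L t))"
    by (intro continuous_intros continuous_on_lattice_map[OF L \<Gamma>])
  from continuous_on_compose2[OF smooth_fun_continuous[OF F(1), of UNIV] this]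
  have cont: "continuous_on UNIV ?g"
    by (intro continuous_on_mult continuous_intros continuous_on_lattice_map[OF L \<Gamma>]) simp
  have "?g (t + inv L Z) = cos (2 * pi * (\<gamma> \<bullet> L t)) * F ((R X, Z) + (0, L t))" for t
    by (simp add: linear_add[OF L(1)] lattice_map_inv[OF L \<Gamma>] add.commute)
  then have "mode_projection F (R X, Z) = integral (cbox 0 One) (\<lambda>t. ?g (t + inv L Z))"
    by (simp only: translate_average_def)
  also have "\<dots> = integral (cbox 0 One) ?g"
    by (rule integral_unit_cube_shift[OF per cont])
  finally show ?thesis
    by (simp add: p twisted_mode_def)
qed

lemma mode_projection_invariant:
  fixes F :: "'v::euclidean_space \<times> 'z \<Rightarrow> real"
  assumes F: "smooth_fun F" "lattice_periodic \<Gamma> F" and W: "\<gamma> \<bullet> W = 0"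
  shows "mode_projection F (q + (0, W)) = mode_projection F q"
proof -
  have "twisted_mode L \<gamma> id F (q + (0, W)) = twisted_mode L \<gamma> id F q"
    using W by (simp add: twisted_mode_def inner_diff_right inner_add_right)
  then show ?thesis
    by (cases q) (simp add: twisted_mode_eq_mode_projection[OF F])
qed

text \<open>
  The frame is invariant under fibre translations, so the Laplacian can be taken under the integral.
\<close>

lemma laplacian_mode_projection:
  fixes F :: "'v::euclidean_space \<times> 'z \<Rightarrow> real"
  assumes J: "metric_two_step_nilpotent J" and F: "smooth_fun F"
    and eigen: "\<And>Y. laplacian (left_inv_metric J) F (fst p, Y) = - \<mu> * F (fst p, Y)"
  shows "laplacian (left_inv_metric J) (mode_projection F) p = - \<mu> * mode_projection F p"
proof -
  let ?w = "\<lambda>t. cos (2 * pi * (\<gamma> \<bullet> L t))" and ?E = "\<lambda>b. frame_field J b p"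
  have "laplacian (left_inv_metric J) (mode_projection F) p =
      (\<Sum>b\<in>Basis. mode_projection (dderiv2 F (?E b) (?E b)) p)"
    by (simp only: laplacian_left_inv_metric[OF J smooth_fun_mode_projection[OF F]]
        dderiv_mode_projection[OF F] fun_cong[OF dderiv_mode_projection[OF smooth_fun_dderiv[OF F]]])
  also have "\<dots> = integral (cbox 0 One)
      (\<lambda>t. \<Sum>b\<in>Basis. ?w t * dderiv2 F (?E b) (?E b) (p + (0, L t)))"
    unfolding translate_average_def
    by (rule integral_sum[symmetric])
      (auto intro!: integrable_translate_integrand[OF continuous_on_mode_projection_data]
        smooth_fun_continuous smooth_fun_dderiv F)
  also have "(\<lambda>t. \<Sum>b\<in>Basis. ?w t * dderiv2 F (?E b) (?E b) (p + (0, L t))) =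
      (\<lambda>t. - \<mu> * (?w t * F (p + (0, L t))))"
  proof
    fix t
    have p: "p + (0, L t) = (fst p, snd p + L t)"
      by (simp add: prod_eq_iff)
    have "?E b = frame_field J b (p + (0, L t))" for b
      by (rule frame_field_cong) simp
    then have "(\<Sum>b\<in>Basis. ?w t * dderiv2 F (?E b) (?E b) (p + (0, L t))) =
        ?w t * laplacian (left_inv_metric J) F (p + (0, L t))"
      by (simp only: laplacian_left_inv_metric[OF J F] sum_distrib_left)
    then show "(\<Sum>b\<in>Basis. ?w t * dderiv2 F (?E b) (?E b) (p + (0, L t))) =
        - \<mu> * (?w t * F (p + (0, L t)))"
      unfolding p eigen by simp
  qed
  also have "integral (cbox 0 One) \<dots> = - \<mu> * mode_projection F p"
    unfolding translate_average_def by (rule integral_mult_right)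
  finally show ?thesis .
qed

context
  fixes J :: "'z \<Rightarrow> 'v::euclidean_space \<Rightarrow> 'v" and \<sigma> R :: "'v \<Rightarrow> 'v" and \<delta> \<mu> :: real
  assumes J: "metric_two_step_nilpotent J" and J': "metric_two_step_nilpotent (sigma_deform \<sigma> J)"
    and R: "orthogonal_transformation R" and JR: "\<And>X. J \<gamma> (R X) = R (\<sigma> (J \<gamma> X))"
begin

lemma linear_rotate_base: "linear (\<lambda>p :: 'v \<times> 'z. (R (fst p), snd p))"
  using orthogonal_transformation_linear[OF R]
  by (intro linearI) (simp_all add: linear_add linear_cmul)

lemma twisted_mode_restrict_ball:
  assumes F: "smooth_fun F" "lattice_periodic \<Gamma> F"
  shows "twisted_mode L \<gamma> R (restrict_ball \<delta> F) =
    restrict_ball \<delta> (\<lambda>p. mode_projection F (R (fst p), snd p))"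
proof
  fix p :: "'v \<times> 'z"
  have "norm (R (fst p)) = norm (fst p)"
    using R by (simp add: orthogonal_transformation_norm)
  then show "twisted_mode L \<gamma> R (restrict_ball \<delta> F) p =
      restrict_ball \<delta> (\<lambda>p. mode_projection F (R (fst p), snd p)) p"
    using twisted_mode_eq_mode_projection[OF F, of R p]
    by (cases "norm (fst p) \<le> \<delta>") (simp_all add: twisted_mode_def restrict_ball_def)
qed

lemma twisted_mode_smooth_periodic_eigen:
  assumes F: "smooth_fun F" "lattice_periodic \<Gamma> F"
    and eigen: "\<forall>p \<in> ball 0 \<delta> \<times> UNIV. laplacian (left_inv_metric J) F p = - \<mu> * F p"
  defines "G \<equiv> \<lambda>p. mode_projection F (R (fst p), snd p)"
  shows "smooth_fun G" "lattice_periodic \<Gamma> G"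
    "\<forall>p \<in> ball 0 \<delta> \<times> UNIV. laplacian (left_inv_metric (sigma_deform \<sigma> J)) G p = - \<mu> * G p"
proof -
  show "smooth_fun G"
    unfolding G_def by (rule smooth_fun_compose_linear[OF linear_rotate_base smooth_fun_mode_projection[OF F(1)]])
  show "lattice_periodic \<Gamma> G"
    using lattice_periodic_mode_projection[OF F(2)] by (simp add: G_def lattice_periodic_def)
  show "\<forall>p \<in> ball 0 \<delta> \<times> UNIV. laplacian (left_inv_metric (sigma_deform \<sigma> J)) G p = - \<mu> * G p"
  proof
    fix p :: "'v \<times> 'z" assume "p \<in> ball 0 \<delta> \<times> UNIV"
    then have "laplacian (left_inv_metric J) F (R (fst p), Y) = - \<mu> * F (R (fst p), Y)" for Y
      using eigen by (auto simp: orthogonal_transformation_norm[OF R])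
    then have "laplacian (left_inv_metric J) (mode_projection F) (R (fst p), snd p) =
        - \<mu> * mode_projection F (R (fst p), snd p)"
      by (intro laplacian_mode_projection[OF J F(1)]) simp
    then show "laplacian (left_inv_metric (sigma_deform \<sigma> J)) G p = - \<mu> * G p"
      using laplacian_sigma_deform_compose[OF J J' R JR smooth_fun_mode_projection[OF F(1)]
          mode_projection_invariant[OF F], of "fst p" "snd p"]
      by (simp add: G_def)
  qed
qed

lemma twisted_mode_dirichlet:
  assumes "f \<in> dirichlet_eigenspace \<Gamma> \<delta> (left_inv_metric J) \<mu>"
  shows "twisted_mode L \<gamma> R f \<in> dirichlet_eigenspace \<Gamma> \<delta> (left_inv_metric (sigma_deform \<sigma> J)) \<mu>"
proof -
  obtain F where f: "f = restrict_ball \<delta> F" and F: "smooth_fun F" "lattice_periodic \<Gamma> F"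
      "\<forall>p \<in> ball 0 \<delta> \<times> UNIV. laplacian (left_inv_metric J) F p = - \<mu> * F p"
    and bd: "\<forall>p \<in> sphere 0 \<delta> \<times> UNIV. F p = 0"
    using assms unfolding dirichlet_eigenspace_def by blast
  have "\<forall>p \<in> sphere 0 \<delta> \<times> UNIV. mode_projection F (R (fst p), snd p) = 0"
    using bd by (auto intro!: mode_projection_eq_0 simp: orthogonal_transformation_norm[OF R])
  then show ?thesis
    unfolding f twisted_mode_restrict_ball[OF F(1,2)] dirichlet_eigenspace_def
    using twisted_mode_smooth_periodic_eigen[OF F] by blast
qed

lemma twisted_mode_neumann:
  assumes "f \<in> neumann_eigenspace \<Gamma> \<delta> (left_inv_metric J) \<mu>"
  shows "twisted_mode L \<gamma> R f \<in> neumann_eigenspace \<Gamma> \<delta> (left_inv_metric (sigma_deform \<sigma> J)) \<mu>"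
proof -
  obtain F where f: "f = restrict_ball \<delta> F" and F: "smooth_fun F" "lattice_periodic \<Gamma> F"
      "\<forall>p \<in> ball 0 \<delta> \<times> UNIV. laplacian (left_inv_metric J) F p = - \<mu> * F p"
    and bd: "\<forall>p \<in> sphere 0 \<delta> \<times> UNIV. \<forall>\<nu>. boundary_normal (left_inv_metric J) p \<nu> \<longrightarrow> dderiv F \<nu> p = 0"
    using assms unfolding neumann_eigenspace_def by blast
  have "dderiv (\<lambda>p. mode_projection F (R (fst p), snd p)) \<nu> p = 0"
    if p: "p \<in> sphere 0 \<delta> \<times> UNIV" and \<nu>: "boundary_normal (left_inv_metric (sigma_deform \<sigma> J)) p \<nu>" for p \<nu>
  proof -
    obtain c where c: "\<nu> = (c *\<^sub>R fst p, 0)"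
      using \<nu> boundary_normal_left_inv_metric_iff[OF J', of "fst p" "snd p" \<nu>] by auto
    have "dderiv F (c *\<^sub>R R (fst p), 0) (R (fst p), Y) = 0" for Y
      using bd p boundary_normal_left_inv_metric_iff[OF J, of "R (fst p)" Y "(c *\<^sub>R R (fst p), 0)"]
      by (auto simp: orthogonal_transformation_norm[OF R])
    then have "mode_projection (dderiv F (c *\<^sub>R R (fst p), 0)) (R (fst p), snd p) = 0"
      by (intro mode_projection_eq_0) simp
    moreover have "dderiv (\<lambda>p. mode_projection F (R (fst p), snd p)) \<nu> p =
        dderiv (mode_projection F) (R (fst \<nu>), snd \<nu>) (R (fst p), snd p)"
      by (rule fun_cong[OF dderiv_compose_linear[OF
        smooth_fun_differentiable[OF smooth_fun_mode_projection[OF F(1)]] linear_rotate_base]])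
    moreover have "\<dots> = mode_projection (dderiv F (R (fst \<nu>), snd \<nu>)) (R (fst p), snd p)"
      by (rule fun_cong[OF dderiv_mode_projection[OF F(1)]])
    ultimately show ?thesis
      using linear_cmul[OF orthogonal_transformation_linear[OF R]] by (simp add: c)
  qed
  then show ?thesis
    unfolding f twisted_mode_restrict_ball[OF F(1,2)] neumann_eigenspace_def
    using twisted_mode_smooth_periodic_eigen[OF F] by blast
qed

end

end

text \<open>
  Opposite frequencies give the same real mode, so independence requires choosing one vector of each
  pair. Choosing from the set \<open>{x, - x}\<close> rather than from \<open>x\<close> makes the choice symmetric.
\<close>

lemma antipodal_representatives:
  fixes D :: "'a::group_add set"
  assumes D: "\<And>x. x \<in> D \<Longrightarrow> - x \<in> D"
  shows "\<exists>I. I \<subseteq> D \<and> (\<forall>x\<in>D. x \<in> I \<or> - x \<in> I) \<and> (\<forall>x\<in>I. \<forall>y\<in>I. x \<noteq> y \<longrightarrow> x \<noteq> - y)"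
proof -
  define rep where "rep x = (SOME y. y \<in> {x, - x})" for x :: 'a
  have rep: "rep x = x \<or> rep x = - x" for x
    using someI[of "\<lambda>y. y \<in> {x, - x}" x] by (auto simp: rep_def)
  have rep_minus: "rep (- x) = rep x" for x
    by (simp add: rep_def insert_commute)
  have rep_rep: "rep (rep x) = rep x" for x
    using rep[of x] rep_minus[of x] by auto
  have "x \<in> rep ` D \<or> - x \<in> rep ` D" if "x \<in> D" for x
    using rep[of x] that by (metis image_eqI)
  moreover have "rep ` D \<subseteq> D"
    using rep D by (metis image_subsetI)
  moreover have "x \<noteq> - y" if "x \<in> rep ` D" "y \<in> rep ` D" "x \<noteq> y" for x y
  proof -
    have "rep x = x" "rep y = y"
      using that(1,2) rep_rep by auto
    then show ?thesis
      using that(3) rep_minus[of y] by auto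
  qed
  ultimately show ?thesis
    by (intro exI[of _ "rep ` D"]) blast
qed

lemma uminus_mem_dual_lattice: "\<gamma> \<in> dual_lattice \<Gamma> \<Longrightarrow> - \<gamma> \<in> dual_lattice \<Gamma>"
  by (simp add: dual_lattice_def)

text \<open>
  The rotated modes map each eigenspace of \<open>J\<close> into the one of the deformed algebra; separation and
  independence of the modes turn this into an inequality of multiplicities.
\<close>

lemma multiplicity_sigma_deform_le:
  fixes J :: "'z::euclidean_space \<Rightarrow> 'v::euclidean_space \<Rightarrow> 'v" and \<sigma> :: "'v \<Rightarrow> 'v"
  assumes J: "metric_two_step_nilpotent J"
    and \<sigma>: "orthogonal_transformation \<sigma>" "\<sigma> \<circ> \<sigma> = id" and comm: "\<And>Z. \<sigma> \<circ> J Z = J Z \<circ> \<sigma>"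
    and \<Gamma>: "full_lattice \<Gamma>"
  shows "multiplicity_of (dirichlet_eigenspace \<Gamma> \<delta> (left_inv_metric J) \<mu>) \<le>
      multiplicity_of (dirichlet_eigenspace \<Gamma> \<delta> (left_inv_metric (sigma_deform \<sigma> J)) \<mu>)"
    and "multiplicity_of (neumann_eigenspace \<Gamma> \<delta> (left_inv_metric J) \<mu>) \<le>
      multiplicity_of (neumann_eigenspace \<Gamma> \<delta> (left_inv_metric (sigma_deform \<sigma> J)) \<mu>)"
proof -
  note J' = metric_two_step_nilpotent_sigma_deform[OF J \<sigma> comm]
  obtain L :: "'z \<Rightarrow> 'z" where L: "linear L" "bij L" "\<Gamma> = L ` {v. int_vector v}"
    using full_lattice_linear_image[OF \<Gamma>] by blast
  from antipodal_representatives[of "dual_lattice \<Gamma>", OF uminus_mem_dual_lattice]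
  obtain I where I_dual: "I \<subseteq> dual_lattice \<Gamma>"
    and I: "\<forall>\<gamma>\<in>dual_lattice \<Gamma>. \<gamma> \<in> I \<or> - \<gamma> \<in> I"
    and antipodal: "\<forall>\<gamma>\<in>I. \<forall>\<gamma>'\<in>I. \<gamma> \<noteq> \<gamma>' \<longrightarrow> \<gamma> \<noteq> - \<gamma>'"
    by blast
  have "\<exists>R. orthogonal_transformation R \<and> (\<forall>x. J \<gamma> (R x) = R (\<sigma> (J \<gamma> x)))" for \<gamma>
    using \<sigma> comm by (intro exists_orthogonal_intertwiner[OF linear_J[OF J] skew_J[OF J]])
      (auto simp: fun_eq_iff)
  then obtain R where R: "\<And>\<gamma>. orthogonal_transformation (R \<gamma>)"
    and JR: "\<And>\<gamma> X. J \<gamma> (R \<gamma> X) = R \<gamma> (\<sigma> (J \<gamma> X))"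
    by metis
  let ?\<Phi> = "\<lambda>\<gamma>. twisted_mode L \<gamma> (R \<gamma>)"
  have le: "multiplicity_of E \<le> multiplicity_of E'"
    if "E \<subseteq> slice_continuous_periodic \<Gamma>" "\<And>\<gamma> f. \<gamma> \<in> I \<Longrightarrow> f \<in> E \<Longrightarrow> ?\<Phi> \<gamma> f \<in> E'"
      "0 \<in> E'" "\<And>f g. f \<in> E' \<Longrightarrow> g \<in> E' \<Longrightarrow> f + g \<in> E'" for E E' :: "('v \<times> 'z \<Rightarrow> real) set"
  proof (rule multiplicity_of_le[where \<Phi> = ?\<Phi> and I = I and C = "slice_continuous_periodic \<Gamma>"])
    show "fun_space.subspace (slice_continuous_periodic \<Gamma> :: ('v \<times> 'z \<Rightarrow> real) set)"
      by (rule subspace_slice_continuous_periodic)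
    show "?\<Phi> \<gamma> (f + g) = ?\<Phi> \<gamma> f + ?\<Phi> \<gamma> g"
      if "f \<in> slice_continuous_periodic \<Gamma>" "g \<in> slice_continuous_periodic \<Gamma>" for f g \<gamma>
      by (rule twisted_mode_add[OF L that])
    show "?\<Phi> \<gamma> (\<lambda>x. c * f x) = (\<lambda>x. c * ?\<Phi> \<gamma> f x)" for \<gamma> c f
      by (rule twisted_mode_scale)
    show "f = 0" if "f \<in> slice_continuous_periodic \<Gamma>" "\<And>\<gamma>. \<gamma> \<in> I \<Longrightarrow> ?\<Phi> \<gamma> f = 0" for f
      by (rule twisted_modes_separate[OF L that(1) I[rule_format] surj_orthogonal_transformation[OF R] that(2)])
    show "\<forall>\<gamma>\<in>M. ?\<Phi> \<gamma> f = 0"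
      if "finite M" "M \<subseteq> I" "f \<in> slice_continuous_periodic \<Gamma>" "(\<Sum>\<gamma>\<in>M. ?\<Phi> \<gamma> f) = 0" for M f
    proof
      fix \<gamma> assume "\<gamma> \<in> M"
      then show "?\<Phi> \<gamma> f = 0"
        using that antipodal
        by (intro twisted_modes_independent[OF L that(3) that(1) _ that(4)]) blast+
    qed
  qed (fact that)+
  show "multiplicity_of (dirichlet_eigenspace \<Gamma> \<delta> (left_inv_metric J) \<mu>) \<le>
      multiplicity_of (dirichlet_eigenspace \<Gamma> \<delta> (left_inv_metric (sigma_deform \<sigma> J)) \<mu>)"
  proof (rule le)
    show "dirichlet_eigenspace \<Gamma> \<delta> (left_inv_metric J) \<mu> \<subseteq> slice_continuous_periodic \<Gamma>"
      by (auto simp: dirichlet_eigenspace_def intro: restrict_ball_in_slice_continuous_periodic)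
    show "?\<Phi> \<gamma> f \<in> dirichlet_eigenspace \<Gamma> \<delta> (left_inv_metric (sigma_deform \<sigma> J)) \<mu>"
      if "\<gamma> \<in> I" "f \<in> dirichlet_eigenspace \<Gamma> \<delta> (left_inv_metric J) \<mu>" for \<gamma> f
      by (rule twisted_mode_dirichlet[OF L subsetD[OF I_dual that(1)] J J' R JR that(2)])
  qed (rule dirichlet_eigenspace_0[OF J'] dirichlet_eigenspace_add[OF J'], assumption?)+
  show "multiplicity_of (neumann_eigenspace \<Gamma> \<delta> (left_inv_metric J) \<mu>) \<le>
      multiplicity_of (neumann_eigenspace \<Gamma> \<delta> (left_inv_metric (sigma_deform \<sigma> J)) \<mu>)"
  proof (rule le)
    show "neumann_eigenspace \<Gamma> \<delta> (left_inv_metric J) \<mu> \<subseteq> slice_continuous_periodic \<Gamma>"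
      by (auto simp: neumann_eigenspace_def intro: restrict_ball_in_slice_continuous_periodic)
    show "?\<Phi> \<gamma> f \<in> neumann_eigenspace \<Gamma> \<delta> (left_inv_metric (sigma_deform \<sigma> J)) \<mu>"
      if "\<gamma> \<in> I" "f \<in> neumann_eigenspace \<Gamma> \<delta> (left_inv_metric J) \<mu>" for \<gamma> f
      by (rule twisted_mode_neumann[OF L subsetD[OF I_dual that(1)] J J' R JR that(2)])
  qed (rule neumann_eigenspace_0[OF J'] neumann_eigenspace_add[OF J'], assumption?)+
qed

theorem theorem3p1:
  fixes J :: "'z::euclidean_space \<Rightarrow> 'v::euclidean_space \<Rightarrow> 'v"
    and \<sigma> :: "'v \<Rightarrow> 'v"
    and \<Gamma> :: "'z set"
    and \<delta> :: real
  assumes "metric_two_step_nilpotent J"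
    and "orthogonal_transformation \<sigma>"
    and "\<sigma> \<circ> \<sigma> = id"
    and "\<And>Z. \<sigma> \<circ> J Z = J Z \<circ> \<sigma>"
    and "full_lattice \<Gamma>"
    and "\<delta> > 0"
  shows "dirichlet_isospectral \<Gamma> \<delta> (left_inv_metric J) (left_inv_metric (sigma_deform \<sigma> J)) \<and>
         neumann_isospectral \<Gamma> \<delta> (left_inv_metric J) (left_inv_metric (sigma_deform \<sigma> J))"
proof -
  have \<sigma>\<sigma>: "\<sigma> (\<sigma> x) = x" for x
    using fun_cong[OF assms(3), of x] by simp
  have comm: "\<sigma> (J Z x) = J Z (\<sigma> x)" for Z x
    using fun_cong[OF assms(4), of Z x] by simp
  have deform_twice: "sigma_deform \<sigma> (sigma_deform \<sigma> J) = J"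
    by (simp add: sigma_deform_def fun_eq_iff \<sigma>\<sigma>)
  have comm': "\<sigma> \<circ> sigma_deform \<sigma> J Z = sigma_deform \<sigma> J Z \<circ> \<sigma>" for Z
    by (simp add: sigma_deform_def fun_eq_iff comm)
  note le = multiplicity_sigma_deform_le[OF assms(1-5)]
  note ge = multiplicity_sigma_deform_le[OF metric_two_step_nilpotent_sigma_deform[OF assms(1-4)]
      assms(2,3) comm' assms(5), unfolded deform_twice]
  show ?thesis
    unfolding dirichlet_isospectral_def neumann_isospectral_def
    using le ge by (intro conjI allI order.antisym)
qed


end
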